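(* Every elementary solvable exact triple is a sub-triple of a standard elementary solvable exact triple.
   Context: **Symplectic symmetric spaces.** A symplectic symmetric space is a triple $(M,\omega,s)$ with $(M,\omega)$ a smooth connected symplectic manifold and $s:M\times M\to M$ smooth such that, writing $s_x(y)=s(x,y)$: each $s_x$ is an involutive symplectic diffeomorphism having $x$ as an isolated fixed point, and $s_xs_ys_x=s_{s_x(y)}$. A symplectic triple is a triple $(\mathfrak g,\sigma,\Omega)$ with $\mathfrak g$ a finite-dimensional real Lie algebra, $\sigma$ an involutive automorphism with $\pm1$-eigenspace decomposition $\mathfrak g=\mathcal K\oplus\mathcal P$ such that $[\mathcal P,\mathcal P]=\mathcal K$ and $\mathcal K$ acts faithfully on $\mathcal P$, and $\Omega$ a Chevalley 2-cocycle (trivial coefficients) on $\mathfrak g$ with $i(\mathcal K)\Omega=0$ and $\Omega|_{\mathcal P\times\mathcal P}$ nondegenerate. Isomorphism classes of symplectic triples correspond bijectively to those of simply connected symplectic symmetric spaces (the Lie algebra being that of the transvection group, generated by the products $s_xs_y$; $\sigma$ is induced by conjugation by the symmetry at a base point $o$; $\Omega$ is the pull-back of $\omega_o$). **Exact triples.** An exact triple is $(\mathfrak g,\sigma,\Omega)$ with $\mathfrak g$ a finite-dimensional real Lie algebra, $\sigma$ an involutive automorphism with $\pm1$-eigenspace decomposition $\mathfrak g=\mathcal K\oplus\mathcal P$, $[\mathcal P,\mathcal P]=\mathcal K$, and $\Omega=\delta\xi$ a Chevalley 2-coboundary ($\xi\in\mathfrak g^\star$, $\Omega(X,Y)=\xi([X,Y])$)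 such that $i(\mathcal K)\Omega=0$ and $\Omega|_{\mathcal P\times\mathcal P}$ is symplectic. The exact triple associated to a symplectic symmetric space is its symplectic triple if $\Omega$ is a coboundary, and otherwise the one-dimensional central extension $\mathfrak g\oplus\mathbb RE$ by the cocycle $\Omega$ (with $\sigma(E)=E$, $\xi(E)=1$). **ESET.** An elementary solvable exact triple (ESET) is an exact triple $(\mathfrak g,\sigma,\Omega)$ associated to a symplectic symmetric space and such that (i) $\mathfrak g=\mathfrak b\rtimes_\rho\mathfrak a$ is a split extension of Abelian Lie algebras $\mathfrak a$ and $\mathfrak b$ ($\mathfrak b$ an ideal, $\rho:\mathfrak a\to\mathrm{End}(\mathfrak b)$ the splitting homomorphism), and (ii) $\sigma$ preserves the splitting $\mathfrak g=\mathfrak b\oplus\mathfrak a$. **Standard.** For $a\in\mathfrak a$, let $\rho(a)=\rho_N(a)+\rho_S(a)$ be the Jordan–Chevalley decomposition (nilpotent plus semisimple part) of $\rho(a)$, extended $\mathbb C$-linearly to $\mathfrak b\otimes\mathbb C$. The ESET is standard if for every $a\in\mathfrak a$ there exist $a^N,a^S\in\mathfrak a$ with $\rho_N(a)=\rho(a^N)$ and $\rho_S(a)=\rho(a^S)$. **Sub-triple.** $(\mathfrak g,\sigma,\Omega)$ is a sub-triple of $(\mathfrak g',\sigma',\Omega')$ if there is an injective Lie algebra homomorphism $j:\mathfrak g\to\mathfrak g'$ with $\sigma'\circ j=j\circ\sigma$ and $j^*\Omega'=\Omega$. *)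

theory Defs
  imports "HOL-Analysis.Analysis" "HOL-Analysis.Finite_Function_Topology"
begin

section \<open>Lie algebras on subspaces\<close>

text \<open>
  The underlying space of a Lie algebra is a subspace of an ambient real vector space, not a whole
  type, so that the dimension of an algebra can be quantified inside a formula.  The functions
  below are unconstrained outside that subspace.  The type \<open>nat \<Rightarrow>\<^sub>0 real\<close> of finitely
  supported sequences has room for a copy of every finite-dimensional real Lie algebra.
\<close>

definition linear_on :: "'v::real_vector set \<Rightarrow> ('v \<Rightarrow> 'w::real_vector) \<Rightarrow> bool" where
  "linear_on V f \<longleftrightarrow>
     (\<forall>x\<in>V. \<forall>y\<in>V. f (x + y) = f x + f y) \<and> (\<forall>c. \<forall>x\<in>V. f (c *\<^sub>R x) = c *\<^sub>R f x)"

definition bilinear_on :: "'v::real_vector set \<Rightarrow> ('v \<Rightarrow> 'v \<Rightarrow> 'w::real_vector) \<Rightarrow> bool" where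
  "bilinear_on V f \<longleftrightarrow> (\<forall>x\<in>V. linear_on V (f x)) \<and> (\<forall>y\<in>V. linear_on V (\<lambda>x. f x y))"

record 'v triple =
  carr :: "'v set"
  brk :: "'v \<Rightarrow> 'v \<Rightarrow> 'v"
  invol :: "'v \<Rightarrow> 'v"
  form :: "'v \<Rightarrow> 'v \<Rightarrow> real"

definition lie_algebra :: "'v::real_vector triple \<Rightarrow> bool" where
  "lie_algebra T \<longleftrightarrow>
     subspace (carr T) \<and> (\<exists>B. finite B \<and> carr T = span B) \<and>
     (\<forall>x\<in>carr T. \<forall>y\<in>carr T. brk T x y \<in> carr T) \<and>
     bilinear_on (carr T) (brk T) \<and>
     (\<forall>x\<in>carr T. brk T x x = 0) \<and>
     (\<forall>x\<in>carr T. \<forall>y\<in>carr T. \<forall>z\<in>carr T.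
        brk T x (brk T y z) + brk T y (brk T z x) + brk T z (brk T x y) = 0)"

definition involutive_automorphism :: "'v::real_vector triple \<Rightarrow> bool" where
  "involutive_automorphism T \<longleftrightarrow>
     linear_on (carr T) (invol T) \<and>
     (\<forall>x\<in>carr T. invol T x \<in> carr T \<and> invol T (invol T x) = x) \<and>
     (\<forall>x\<in>carr T. \<forall>y\<in>carr T. invol T (brk T x y) = brk T (invol T x) (invol T y))"

definition K_space :: "'v::real_vector triple \<Rightarrow> 'v set" where
  "K_space T = {x \<in> carr T. invol T x = x}"

definition P_space :: "'v::real_vector triple \<Rightarrow> 'v set" where
  "P_space T = {x \<in> carr T. invol T x = - x}"

definition PP_generates_K :: "'v::real_vector triple \<Rightarrow> bool" where
  "PP_generates_K T \<longleftrightarrow> span {brk T x y | x y. x \<in> P_space T \<and> y \<in> P_space T} = K_space T"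

definition K_faithful_on_P :: "'v::real_vector triple \<Rightarrow> bool" where
  "K_faithful_on_P T \<longleftrightarrow> (\<forall>k\<in>K_space T. (\<forall>p\<in>P_space T. brk T k p = 0) \<longrightarrow> k = 0)"

definition chevalley_cocycle :: "'v::real_vector triple \<Rightarrow> bool" where
  "chevalley_cocycle T \<longleftrightarrow>
     bilinear_on (carr T) (form T) \<and> (\<forall>x\<in>carr T. form T x x = 0) \<and>
     (\<forall>x\<in>carr T. \<forall>y\<in>carr T. \<forall>z\<in>carr T.
        form T (brk T x y) z + form T (brk T y z) x + form T (brk T z x) y = 0)"

definition chevalley_coboundary :: "'v::real_vector triple \<Rightarrow> bool" where
  "chevalley_coboundary T \<longleftrightarrow>
     (\<exists>\<xi> :: 'v \<Rightarrow> real. linear_on (carr T) \<xi> \<and>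
        (\<forall>x\<in>carr T. \<forall>y\<in>carr T. form T x y = \<xi> (brk T x y)))"

definition K_contraction_zero :: "'v::real_vector triple \<Rightarrow> bool" where
  "K_contraction_zero T \<longleftrightarrow> (\<forall>k\<in>K_space T. \<forall>x\<in>carr T. form T k x = 0)"

definition nondegenerate_on_P :: "'v::real_vector triple \<Rightarrow> bool" where
  "nondegenerate_on_P T \<longleftrightarrow> (\<forall>x\<in>P_space T. (\<forall>y\<in>P_space T. form T x y = 0) \<longrightarrow> x = 0)"


section \<open>Symplectic and exact triples\<close>

definition symplectic_triple :: "'v::real_vector triple \<Rightarrow> bool" where
  "symplectic_triple T \<longleftrightarrow>
     lie_algebra T \<and> involutive_automorphism T \<and> PP_generates_K T \<and> K_faithful_on_P T \<and>
     chevalley_cocycle T \<and> K_contraction_zero T \<and> nondegenerate_on_P T"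

text \<open>Skew-symmetry of the form is automatic for a coboundary.\<close>

definition exact_triple :: "'v::real_vector triple \<Rightarrow> bool" where
  "exact_triple T \<longleftrightarrow>
     lie_algebra T \<and> involutive_automorphism T \<and> PP_generates_K T \<and>
     chevalley_coboundary T \<and> K_contraction_zero T \<and> nondegenerate_on_P T"

definition triple_hom :: "'v::real_vector triple \<Rightarrow> 'w::real_vector triple \<Rightarrow> ('v \<Rightarrow> 'w) \<Rightarrow> bool" where
  "triple_hom T T' j \<longleftrightarrow>
     j ` carr T \<subseteq> carr T' \<and> linear_on (carr T) j \<and>
     (\<forall>x\<in>carr T. \<forall>y\<in>carr T. j (brk T x y) = brk T' (j x) (j y)) \<and>
     (\<forall>x\<in>carr T. invol T' (j x) = j (invol T x)) \<and>
     (\<forall>x\<in>carr T. \<forall>y\<in>carr T. form T' (j x) (j y) = form T x y)"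

definition sub_triple :: "'v::real_vector triple \<Rightarrow> 'w::real_vector triple \<Rightarrow> bool" where
  "sub_triple T T' \<longleftrightarrow> (\<exists>j. triple_hom T T' j \<and> inj_on j (carr T))"

definition isomorphic_triples :: "'v::real_vector triple \<Rightarrow> 'w::real_vector triple \<Rightarrow> bool" where
  "isomorphic_triples T T' \<longleftrightarrow> (\<exists>j. triple_hom T T' j \<and> bij_betw j (carr T) (carr T'))"

text \<open>
  The extension by \<open>E = (0, 1)\<close> with cocycle \<open>form T\<close>.  The new form is the coboundary of
  \<open>\<xi> = snd\<close>, i.e. \<open>\<xi> E = 1\<close> and \<open>\<xi> = 0\<close> on the copy of \<open>carr T\<close>; it is the pull-back of \<open>form T\<close>.
\<close>

definition central_extension :: "'v::real_vector triple \<Rightarrow> ('v \<times> real) triple" where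
  "central_extension T =
     \<lparr> carr = carr T \<times> UNIV,
       brk = (\<lambda>(x, s) (y, t). (brk T x y, form T x y)),
       invol = (\<lambda>(x, s). (invol T x, s)),
       form = (\<lambda>(x, s) (y, t). form T x y) \<rparr>"

text \<open>
  Symplectic symmetric spaces enter only through their symplectic triples: every symplectic
  symmetric space has one, and every symplectic triple is that of a (simply connected) symplectic
  symmetric space, so \<open>T\<^sub>0\<close> ranges over the triples of symplectic symmetric spaces.
  Taking \<open>T\<^sub>0\<close> in the same ambient type as \<open>T\<close> is no restriction, since
  \<open>T\<^sub>0\<close> has at most the dimension of \<open>T\<close>.
\<close>

definition associated_exact_triple :: "'v::real_vector triple \<Rightarrow> 'w::real_vector triple \<Rightarrow> bool" where
  "associated_exact_triple T\<^sub>0 T \<longleftrightarrow>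
     (if chevalley_coboundary T\<^sub>0 then isomorphic_triples T T\<^sub>0
      else isomorphic_triples T (central_extension T\<^sub>0))"

definition associated_to_symplectic_symmetric_space :: "'v::real_vector triple \<Rightarrow> bool" where
  "associated_to_symplectic_symmetric_space T \<longleftrightarrow>
     (\<exists>T\<^sub>0 :: 'v triple. symplectic_triple T\<^sub>0 \<and> associated_exact_triple T\<^sub>0 T)"


section \<open>Elementary solvable exact triples\<close>

definition split_abelian_extension :: "'v::real_vector triple \<Rightarrow> 'v set \<Rightarrow> 'v set \<Rightarrow> bool" where
  "split_abelian_extension T \<bb> \<aa> \<longleftrightarrow>
     subspace \<bb> \<and> subspace \<aa> \<and> \<bb> \<inter> \<aa> = {0} \<and> carr T = {x + y | x y. x \<in> \<bb> \<and> y \<in> \<aa>} \<and>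
     (\<forall>x\<in>carr T. \<forall>y\<in>\<bb>. brk T x y \<in> \<bb>) \<and>
     (\<forall>x\<in>\<bb>. \<forall>y\<in>\<bb>. brk T x y = 0) \<and>
     (\<forall>x\<in>\<aa>. \<forall>y\<in>\<aa>. brk T x y = 0)"

definition ESET :: "'v::real_vector triple \<Rightarrow> 'v set \<Rightarrow> 'v set \<Rightarrow> bool" where
  "ESET T \<bb> \<aa> \<longleftrightarrow>
     exact_triple T \<and> associated_to_symplectic_symmetric_space T \<and>
     split_abelian_extension T \<bb> \<aa> \<and> invol T ` \<bb> \<subseteq> \<bb> \<and> invol T ` \<aa> \<subseteq> \<aa>"


section \<open>Jordan--Chevalley decomposition\<close>

text \<open>
  The complexification of \<open>V\<close> is \<open>V \<times> V\<close>, with \<open>(u, v)\<close> standing for \<open>u + \<i> v\<close>; the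
  complex-linear extension of \<open>f\<close> is \<open>map_prod f f\<close>.
\<close>

definition cscale :: "complex \<Rightarrow> 'v::real_vector \<times> 'v \<Rightarrow> 'v \<times> 'v" where
  "cscale c w = (Re c *\<^sub>R fst w - Im c *\<^sub>R snd w, Re c *\<^sub>R snd w + Im c *\<^sub>R fst w)"

global_interpretation cplx: vector_space cscale
  by unfold_locales (auto simp: cscale_def algebra_simps)

definition semisimple_on :: "'v::real_vector set \<Rightarrow> ('v \<Rightarrow> 'v) \<Rightarrow> bool" where
  "semisimple_on V f \<longleftrightarrow>
     cplx.span {w \<in> V \<times> V. \<exists>\<mu>. map_prod f f w = cscale \<mu> w} = V \<times> V"

definition nilpotent_on :: "'v::real_vector set \<Rightarrow> ('v \<Rightarrow> 'v) \<Rightarrow> bool" where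
  "nilpotent_on V f \<longleftrightarrow> (\<exists>n. \<forall>v\<in>V. (f ^^ n) v = 0)"

definition endomorphism_on :: "'v::real_vector set \<Rightarrow> ('v \<Rightarrow> 'v) \<Rightarrow> bool" where
  "endomorphism_on V f \<longleftrightarrow> f ` V \<subseteq> V \<and> linear_on V f"

definition jordan_chevalley :: "'v::real_vector set \<Rightarrow> ('v \<Rightarrow> 'v) \<Rightarrow> ('v \<Rightarrow> 'v) \<Rightarrow> ('v \<Rightarrow> 'v) \<Rightarrow> bool" where
  "jordan_chevalley V f f\<^sub>N f\<^sub>S \<longleftrightarrow>
     endomorphism_on V f\<^sub>N \<and> endomorphism_on V f\<^sub>S \<and>
     nilpotent_on V f\<^sub>N \<and> semisimple_on V f\<^sub>S \<and>
     (\<forall>v\<in>V. f v = f\<^sub>N v + f\<^sub>S v) \<and> (\<forall>v\<in>V. f\<^sub>N (f\<^sub>S v) = f\<^sub>S (f\<^sub>N v))"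

text \<open>
  The splitting homomorphism \<open>\<rho>\<close> is \<open>brk T\<close>, restricted to \<open>\<aa>\<close> acting on \<open>\<bb>\<close>.  Since the
  Jordan--Chevalley decomposition is unique, the condition says that the nilpotent and the
  semisimple part of \<open>\<rho> a\<close> are \<open>\<rho> a\<^sub>N\<close> and \<open>\<rho> a\<^sub>S\<close>.
\<close>

definition standard_ESET :: "'v::real_vector triple \<Rightarrow> 'v set \<Rightarrow> 'v set \<Rightarrow> bool" where
  "standard_ESET T \<bb> \<aa> \<longleftrightarrow>
     ESET T \<bb> \<aa> \<and>
     (\<forall>a\<in>\<aa>. \<exists>a\<^sub>N\<in>\<aa>. \<exists>a\<^sub>S\<in>\<aa>. jordan_chevalley \<bb> (brk T a) (brk T a\<^sub>N) (brk T a\<^sub>S))"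

end

theory Submission
  imports Defs
    "HOL-Computational_Algebra.Polynomial_Factorial"
    "HOL-Computational_Algebra.Field_as_Ring"
    "HOL-Computational_Algebra.Fundamental_Theorem_Algebra"
begin

text \<open>
  Every elementary solvable exact triple \<open>\<bb> \<rtimes> \<aa>\<close> is already standard, so only a copy of it
  in the prescribed ambient space has to be made.  Since \<open>\<K> = [\<P>, \<P>] \<subseteq> \<bb>\<close>, the involution
  \<open>\<sigma>\<close> is \<open>-1\<close> on \<open>\<aa>\<close>, and \<open>(a, p) \<mapsto> \<xi> [a, p]\<close> is a perfect pairing of \<open>\<aa>\<close> with the odd part
  \<open>\<bb>\<^sub>1\<close> of \<open>\<bb>\<close>.  Let \<open>S\<close> be the semisimple part of \<open>\<rho> a\<close>.  It is an odd polynomial in \<open>\<rho> a\<close>,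
  hence it anticommutes with \<open>\<sigma>\<close> and commutes with \<open>\<rho> \<aa>\<close>.  Choose \<open>a'\<close> in \<open>\<aa>\<close> with
  \<open>\<xi> [a', p] = \<xi> (S p)\<close> for all \<open>p\<close> in \<open>\<bb>\<^sub>1\<close>, and put \<open>D = S - \<rho> a'\<close>.  For even \<open>v\<close> in \<open>\<bb>\<close> and \<open>u\<close> in \<open>\<aa>\<close> we have
  \<open>\<xi> [u, D v] = \<xi> (D [u, v]) = 0\<close>, so \<open>D v = 0\<close>.  For odd \<open>v\<close> it follows that \<open>D v\<close> in \<open>\<K>\<close> acts
  trivially on \<open>\<P>\<close>, while \<open>\<xi> (D v) = 0\<close>; for a triple associated to a symplectic symmetric space
  this forces \<open>D v = 0\<close>.  Hence \<open>S = \<rho> a'\<close>.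
\<close>

section \<open>The semisimple part as an odd polynomial\<close>

text \<open>With \<open>g\<close> the gcd of \<open>d\<close> and its derivative, write
  \<open>d = g * k\<close> and \<open>pderiv d = g * e\<close>. Since \<open>k\<close> is coprime to
  \<open>e\<close>, it divides \<open>c\<close>; the product rule then passes the hypothesis on to
  \<open>g\<close>, which has smaller degree. If \<open>g\<close> divides a power of
  \<open>c\<close>, then \<open>g * k\<close> divides the next power.\<close>

lemma dvd_power_if_dvd_mult_pderiv:
  fixes c d :: "'a::{field_char_0, field_gcd} poly"
  assumes "d \<noteq> 0" "d dvd c * pderiv d"
  shows "\<exists>m. d dvd c ^ m"
  using assms
proof (induction "degree d" arbitrary: d rule: less_induct)
  case less
  show ?case
  proof (cases "degree d = 0")
    case True
    with less.prems(1) have "is_unit d" by (simp add: is_unit_iff_degree)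
    then show ?thesis by blast
  next
    case False
    define g where "g = gcd d (pderiv d)"
    obtain k where k: "d = g * k" unfolding g_def by (meson dvd_def gcd_dvd1)
    obtain e where e: "pderiv d = g * e" unfolding g_def by (meson dvd_def gcd_dvd2)
    have g0: "g \<noteq> 0" and k0: "k \<noteq> 0" using k less.prems(1) by auto
    have "coprime k e"
      by (rule gcd_coprime[of d "pderiv d"], unfold g_def[symmetric]) (rule g0, subst k, rule mult.commute, subst e, rule mult.commute)
    \<comment> \<open>Otherwise \<open>d\<close> would divide its derivative, which in
      characteristic zero is nonzero of smaller degree.\<close>
    have "degree g \<noteq> degree d"
    proof
      assume "degree g = degree d"
      then have "degree k = 0" using k k0 g0 by (simp add: degree_mult_eq)
      then have "is_unit k" using k0 by (simp add: is_unit_iff_degree)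
      then have "d dvd pderiv d" by (metis \<open>is_unit k\<close> e k dvd_refl dvd_triv_left dvd_trans mult_unit_dvd_iff)
      then show False using False by simp
    qed
    then have deg: "degree g < degree d"
      using k k0 g0 by (auto simp: degree_mult_eq)
    have "g * k dvd g * (c * e)" using less.prems(2) k e by (simp add: ac_simps)
    then have "k dvd c * e" using g0 by simp
    then have kc: "k dvd c" using \<open>coprime k e\<close> by (simp add: coprime_dvd_mult_left_iff)
    \<comment> \<open>The term with \<open>pderiv k\<close> is divisible by \<open>g * k\<close>
      because \<open>k dvd c\<close>. Removing it and cancelling \<open>k\<close> leaves the
      hypothesis for \<open>g\<close>.\<close>
    have "g * k dvd c * (g * pderiv k + k * pderiv g)"
      using less.prems(2) k by (simp add: pderiv_mult)
    moreover have "g * k dvd c * (g * pderiv k)"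
      using mult_dvd_mono[OF dvd_refl[of g] kc] by (simp add: mult.left_commute[of c g] mult.assoc[symmetric])
    ultimately have "g * k dvd c * (k * pderiv g)"
      by (simp only: distrib_left dvd_add_right_iff)
    then have "k * g dvd k * (c * pderiv g)" by (simp only: ac_simps)
    then have "g dvd c * pderiv g" using k0 by simp
    from less.hyps[OF deg g0 this] obtain m where "g dvd c ^ m" by blast
    then have "d dvd c ^ Suc m" using k kc by (metis mult.commute mult_dvd_mono power_Suc2)
    then show ?thesis by blast
  qed
qed

text \<open>The radical of \<open>p\<close> is obtained as a polynomial of least degree among those
  with a power divisible by \<open>p\<close>. Minimality yields both properties without a
  factorization into irreducibles.\<close>

lemma separable_kernel:
  fixes p :: "'a::{field_char_0, field_gcd} poly"
  assumes "p \<noteq> 0"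
  obtains q n where "coprime q (pderiv q)" "p dvd q ^ n" "\<And>g m. p dvd g ^ m \<Longrightarrow> q dvd g"
proof -
  define C where "C = (\<lambda>q. q \<noteq> 0 \<and> (\<exists>n. p dvd q ^ n))"
  have "C p" using assms by (auto simp: C_def intro: exI[of _ 1])
  then obtain q where q: "C q" and min: "\<And>r. C r \<Longrightarrow> degree q \<le> degree r"
    by (meson ex_has_least_nat[of C p degree])
  then obtain n where n: "p dvd q ^ n" and q0: "q \<noteq> 0" by (auto simp: C_def)
  \<comment> \<open>The gcd of \<open>q\<close> and \<open>g\<close> also has a power divisible by
    \<open>p\<close>, so by minimality it has the degree of \<open>q\<close>.\<close>
  have "q dvd g" if "p dvd g ^ m" for g m
  proof -
    define k where "k = max n m"
    have "p dvd q ^ k" "p dvd g ^ k"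
      using dvd_trans[OF n le_imp_power_dvd, of k] dvd_trans[OF that le_imp_power_dvd, of k]
      by (simp_all add: k_def)
    then have "p dvd gcd q g ^ k" by (metis gcd_exp gcd_greatest)
    then have "C (gcd q g)" using q0 by (auto simp: C_def)
    then have "degree q \<le> degree (gcd q g)" by (rule min)
    moreover obtain u where u: "q = gcd q g * u" by (meson dvd_def gcd_dvd1)
    moreover have "gcd q g \<noteq> 0" "u \<noteq> 0" using u q0 by auto
    ultimately have "degree u = 0"
      by (metis add_le_same_cancel1 degree_mult_eq le_zero_eq)
    then have "is_unit u" using \<open>u \<noteq> 0\<close> by (simp add: is_unit_iff_degree)
    then have "q dvd gcd q g" by (metis u dvd_refl mult_unit_dvd_iff)
    then show ?thesis by simp
  qed
  \<comment> \<open>Let \<open>d\<close> be the gcd and \<open>c\<close> its cofactor in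
    \<open>q\<close>. Then \<open>d\<close> divides a power of \<open>c\<close>, so \<open>c\<close>
    too has a power divisible by \<open>p\<close>, and minimality leaves \<open>d\<close>
    constant.\<close>
  moreover have "coprime q (pderiv q)"
  proof -
    define d where "d = gcd q (pderiv q)"
    obtain c where c: "q = c * d" unfolding d_def by (metis dvd_def gcd_dvd1 mult.commute)
    have c0: "c \<noteq> 0" and d0: "d \<noteq> 0" using c q0 by auto
    have "d dvd c * pderiv d + d * pderiv c"
      by (metis c d_def gcd_dvd2 pderiv_mult)
    then have "d dvd c * pderiv d" by (simp add: dvd_add_left_iff)
    then obtain m where "d dvd c ^ m" using dvd_power_if_dvd_mult_pderiv d0 by blast
    then have "q dvd c ^ Suc m" using c by (simp add: mult_dvd_mono)
    then have "q ^ n dvd (c ^ Suc m) ^ n" by (rule dvd_power_same)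
    then have "p dvd c ^ (Suc m * n)" using n by (metis dvd_trans power_mult)
    then have "degree q \<le> degree c" using min[of c] c0 by (auto simp: C_def)
    then have "degree d = 0" using c c0 d0 by (simp add: degree_mult_eq)
    then have "is_unit d" using d0 by (simp add: is_unit_iff_degree)
    then show ?thesis by (simp add: d_def coprime_iff_gcd_eq_1)
  qed
  ultimately show ?thesis using n that by blast
qed

section \<open>Taylor expansion, parity and Newton iteration for polynomials\<close>

lemma pcompose_taylor:
  fixes p s h :: "'a::idom poly"
  shows "\<exists>t. pcompose p (s + h) = pcompose p s + h * pcompose (pderiv p) s + h ^ 2 * t"
proof (induction p)
  case (pCons a p)
  then obtain t where t: "pcompose p (s + h) = pcompose p s + h * pcompose (pderiv p) s + h ^ 2 * t"
    by blast
  \<comment> \<open>The witness collects the terms with factor \<open>h ^ 2\<close> after the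
    induction hypothesis is multiplied by \<open>s + h\<close>.\<close>
  show ?case
    by (rule exI[of _ "pcompose (pderiv p) s + (s + h) * t"])
      (simp only: pcompose_pCons pderiv_pCons t pcompose_add pcompose_0, simp add: algebra_simps power2_eq_square)
qed simp

text \<open>Substitution of -X. An odd polynomial in an endomorphism changes sign with the
  endomorphism, which later gives anticommutation with the involution.\<close>

abbreviation reflect :: "'a::comm_ring_1 poly \<Rightarrow> 'a poly" where
  "reflect p \<equiv> pcompose p [:0, -1:]"

lemma reflect_reflect [simp]: "reflect (reflect p) = (p :: 'a::comm_ring_1 poly)"
  by (simp add: pcompose_assoc[symmetric] pcompose_pCons)

lemma pcompose_uminus_right: "pcompose p (- s) = pcompose (reflect p) (s :: 'a::comm_ring_1 poly)"
  by (simp add: pcompose_assoc[symmetric] pcompose_pCons)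

lemma pcompose_power: "pcompose (p ^ n) r = pcompose p (r :: 'a::comm_ring_1 poly) ^ n"
  by (induction n) (simp_all add: pcompose_mult pcompose_1)

text \<open>Reflection preserves the degree, so the quotient is a constant, and reflecting twice
  shows that its square is 1. Hence \<open>q\<close> is even or odd.\<close>

lemma reflect_eq_smult_of_dvd:
  fixes q :: "'a::field poly"
  assumes "q \<noteq> 0" "q dvd reflect q"
  obtains \<epsilon> where "reflect q = smult \<epsilon> q" "\<epsilon> * \<epsilon> = 1"
proof -
  obtain u where u: "reflect q = q * u" using assms(2) by blast
  have deg: "degree (reflect q) = degree q" by (simp add: degree_pcompose)
  have "reflect q \<noteq> 0" using assms(1) by (metis pcompose_0 reflect_reflect)
  then have "u \<noteq> 0" using u by auto
  then have "degree u = 0" using u deg assms(1) by (simp add: degree_mult_eq)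
  then obtain e where e: "u = [:e:]" by (meson degree_eq_zeroE)
  then have 1: "reflect q = smult e q" using u by simp
  then have "q = smult (e * e) q" by (metis pcompose_smult reflect_reflect smult_smult)
  then have "smult (e * e - 1) q = 0" by (simp add: smult_diff_left)
  then have "e * e = 1" using assms(1) by simp
  with 1 that show ?thesis by blast
qed

text \<open>Newton iteration for a root of \<open>q\<close>, started at \<open>x\<close>, converges \<open>q\<close>-adically.
  If \<open>q\<close> has a parity then every iterate is odd.\<close>

lemma newton_iterate:
  fixes q :: "'a::{field_char_0, field_gcd} poly"
  assumes "coprime q (pderiv q)" "reflect q = smult \<epsilon> q" "\<epsilon> * \<epsilon> = 1"
  shows "\<exists>s. q ^ Suc n dvd pcompose q s \<and> q dvd s - [:0, 1:] \<and> reflect s = - s"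
proof (induction n)
  case 0
  show ?case by (rule exI[of _ "[:0, 1:]"]) (simp add: pcompose_pCons)
next
  case (Suc n)
  then obtain s where s: "q ^ Suc n dvd pcompose q s" "q dvd s - [:0, 1:]" "reflect s = - s"
    by blast
  \<comment> \<open>By Bezout, \<open>r0\<close> inverts the derivative modulo
    \<open>q\<close>.\<close>
  obtain r0 where r0: "q dvd 1 - r0 * pderiv q"
  proof -
    obtain a b where "a * q + b * pderiv q = 1"
      using assms(1) bezout_coefficients_fst_snd[of q "pderiv q"] by (auto simp: coprime_iff_gcd_eq_1)
    then have "1 - b * pderiv q = q * a" by (simp add: algebra_simps)
    then show ?thesis using that by (metis dvd_triv_left)
  qed
  have "pderiv (reflect q) = - reflect (pderiv q)"
    by (simp add: pderiv_pcompose pderiv_pCons)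
  then have q': "reflect (pderiv q) = smult (- \<epsilon>) (pderiv q)"
    using assms(2) by (simp add: pderiv_smult)
  \<comment> \<open>Reflecting the congruence makes the signed reflection of \<open>r0\<close> a
    second inverse modulo \<open>q\<close>.\<close>
  have "reflect q dvd reflect (1 - r0 * pderiv q)"
    using r0 by (metis dvd_def pcompose_mult)
  then have "q dvd 1 - smult (- \<epsilon>) (reflect r0) * pderiv q"
    using assms(2,3) by (simp add: pcompose_diff pcompose_mult pcompose_1 q' smult_dvd_iff split: if_splits)
  with r0 have "q dvd (1 - r0 * pderiv q) + (1 - smult (- \<epsilon>) (reflect r0) * pderiv q)"
    by (rule dvd_add)
  then have "q dvd smult (1/2) ((1 - r0 * pderiv q) + (1 - smult (- \<epsilon>) (reflect r0) * pderiv q))"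
    by (rule dvd_smult)
  \<comment> \<open>The average of the two inverses is again an inverse modulo \<open>q\<close>, and
    it has the definite parity -\<epsilon>.\<close>
  moreover define r where "r = smult (1/2) (r0 + smult (- \<epsilon>) (reflect r0))"
  have "smult (1/2) ((1 - r0 * pderiv q) + (1 - smult (- \<epsilon>) (reflect r0) * pderiv q))
      = smult (1/2) (1 + 1) - r * pderiv q"
  proof -
    have "smult (1/2) ((1 - A) + (1 - B)) = smult (1/2) (1 + 1) - smult (1/2) (A + B)" for A B :: "'a poly"
      by (simp add: smult_add_right smult_diff_right)
    then show ?thesis by (simp only: r_def distrib_right mult_smult_left)
  qed
  moreover have "smult (1/2) (1 + 1) = (1 :: 'a poly)"
    by (simp add: one_pCons)
  ultimately obtain u where u: "1 - r * pderiv q = q * u" by (metis dvd_def)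
  have r: "reflect r = smult (- \<epsilon>) r"
    using assms(3) by (simp add: r_def pcompose_smult pcompose_add pcompose_diff algebra_simps smult_add_right smult_diff_right)
  \<comment> \<open>The Newton correction, with \<open>r\<close> standing in for the reciprocal of
    the derivative. The terms of order zero and one cancel up to a multiple of the square of
    \<open>pcompose q s\<close>, so the exponent doubles; only an increase by one is kept.\<close>
  define h where "h = - (pcompose q s * pcompose r s)"
  obtain t where t: "pcompose q (s + h) = pcompose q s + h * pcompose (pderiv q) s + h ^ 2 * t"
    using pcompose_taylor by blast
  have "pcompose (1 - r * pderiv q) s = pcompose q s * pcompose u s"
    by (simp add: u pcompose_mult)
  then have "1 - pcompose r s * pcompose (pderiv q) s = pcompose q s * pcompose u s"
    by (simp add: pcompose_diff pcompose_mult pcompose_1)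
  then have "pcompose q s * (1 - pcompose r s * pcompose (pderiv q) s) = pcompose q s * (pcompose q s * pcompose u s)"
    by simp
  then have "pcompose q (s + h) = pcompose q s ^ 2 * (pcompose u s + pcompose r s ^ 2 * t)"
    unfolding t by (simp add: h_def algebra_simps power2_eq_square)
  moreover have "q ^ Suc (Suc n) dvd pcompose q s ^ 2"
  proof -
    have "q ^ Suc n * q ^ Suc n dvd pcompose q s ^ 2"
      using s(1) by (simp add: mult_dvd_mono power2_eq_square del: power_Suc)
    then show ?thesis
      by (metis add_Suc_right add_Suc dvd_trans le_add2 le_imp_power_dvd power_add)
  qed
  ultimately have "q ^ Suc (Suc n) dvd pcompose q (s + h)" by (metis dvd_mult2)
  moreover have "q dvd s + h - [:0, 1:]"
  proof -
    have "q dvd pcompose q s" using s(1) by (metis dvd_mult_left power_Suc)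
    then have "q dvd h" by (simp add: h_def)
    then have "q dvd (s - [:0, 1:]) + h" using s(2) by (rule dvd_add[rotated])
    then show ?thesis by (simp add: algebra_simps)
  qed
  \<comment> \<open>As \<open>s\<close> is odd, the two factors of \<open>h\<close> have parities
    \<epsilon> and -\<epsilon>, so their product is odd.\<close>
  moreover have "reflect (s + h) = - (s + h)"
  proof -
    have "reflect (pcompose f s) = pcompose (reflect f) s" for f
      by (metis pcompose_assoc s(3) pcompose_uminus_right)
    then have "reflect h = - h"
      using assms(3) by (simp add: h_def pcompose_uminus pcompose_mult pcompose_smult assms(2) r)
    then show ?thesis by (simp add: pcompose_add s(3))
  qed
  ultimately show ?case by blast
qed

text \<open>If \<open>p\<close> annihilates an endomorphism, then \<open>s\<close> evaluated at it
  is the semisimple part: it is killed by the separable \<open>q\<close>, and X - s is nilpotent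
  modulo \<open>p\<close>. Since \<open>p\<close> is even, the reflection of its radical is again
  divisible by that radical, so the radical has a parity and Newton iteration stays odd.\<close>

lemma odd_semisimple_part_poly:
  fixes p :: "'a::{field_char_0, field_gcd} poly"
  assumes "p \<noteq> 0" "reflect p = p"
  obtains q n s where "coprime q (pderiv q)" "p dvd pcompose q s" "p dvd ([:0, 1:] - s) ^ n"
    "reflect s = - s"
proof -
  obtain q n where q: "coprime q (pderiv q)" "p dvd q ^ n" "\<And>g m. p dvd g ^ m \<Longrightarrow> q dvd g"
    using separable_kernel[OF assms(1)] by metis
  have "q \<noteq> 0" using q(1) by auto
  have "reflect p dvd reflect q ^ n" using q(2) by (metis dvd_def pcompose_mult pcompose_power)
  then have "q dvd reflect q" using q(3) assms(2) by metis
  then obtain \<epsilon> where e: "reflect q = smult \<epsilon> q" "\<epsilon> * \<epsilon> = 1"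
    using reflect_eq_smult_of_dvd \<open>q \<noteq> 0\<close> by metis
  obtain s where s: "q ^ Suc n dvd pcompose q s" "q dvd s - [:0, 1:]" "reflect s = - s"
    using newton_iterate[OF q(1) e] by blast
  have "p dvd pcompose q s" using q(2) s(1) by (metis dvd_trans dvd_mult_right power_Suc)
  moreover have "p dvd ([:0, 1:] - s) ^ n"
    using q(2) s(2) by (meson dvd_diff_commute dvd_power_same dvd_trans)
  ultimately show ?thesis using that q(1) s(3) by blast
qed

section \<open>Polynomials in a linear map\<close>

text \<open>Evaluation at an endomorphism by Horner's scheme. The scalar multiplication is a
  parameter so that one definition serves real spaces and their complexifications.\<close>

definition poly_act :: "('k::field \<Rightarrow> 'v::ab_group_add \<Rightarrow> 'v) \<Rightarrow> 'k poly \<Rightarrow> ('v \<Rightarrow> 'v) \<Rightarrow> 'v \<Rightarrow> 'v" where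
  "poly_act sm p f = fold_coeffs (\<lambda>a g v. sm a v + f (g v)) p (\<lambda>_. 0)"

lemma poly_act_0 [simp]: "poly_act sm 0 f v = 0"
  by (simp add: poly_act_def)

context
  fixes sm :: "'k::field \<Rightarrow> 'v::ab_group_add \<Rightarrow> 'v" and f :: "'v \<Rightarrow> 'v"
  assumes lin: "Vector_Spaces.linear sm sm f"
begin

interpretation Vector_Spaces.linear sm sm f
  by (rule lin)

lemma poly_act_pCons [simp]:
  "poly_act sm (pCons a p) f v = sm a v + f (poly_act sm p f v)"
  by (cases "a = 0 \<and> p = 0") (auto simp: poly_act_def zero)

lemma linear_poly_act: "Vector_Spaces.linear sm sm (poly_act sm p f)"
proof (induction p)
  case 0
  show ?case by unfold_locales (auto simp: vs1.scale_zero_right)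
next
  case (pCons a p)
  then interpret p: Vector_Spaces.linear sm sm "poly_act sm p f" by simp
  show ?case
    by unfold_locales (auto simp: p.add p.scale add scale vs1.scale_right_distrib vs1.scale_left_commute)
qed

lemma poly_act_add: "poly_act sm (p + q) f v = poly_act sm p f v + poly_act sm q f v"
  by (induction p q rule: poly_induct2) (auto simp: vs1.scale_left_distrib add)

lemma poly_act_smult: "poly_act sm (smult c p) f v = sm c (poly_act sm p f v)"
  by (induction p) (auto simp: vs1.scale_right_distrib scale)

lemma poly_act_uminus: "poly_act sm (- p) f v = - poly_act sm p f v"
  using poly_act_smult[of "-1" p v] by simp

lemma poly_act_mult: "poly_act sm (p * q) f v = poly_act sm p f (poly_act sm q f v)"
  by (induction p) (auto simp: mult_pCons_left poly_act_add poly_act_smult)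

lemma poly_act_power: "poly_act sm (p ^ n) f v = (poly_act sm p f ^^ n) v"
  by (induction n arbitrary: v) (auto simp: one_pCons poly_act_mult zero)

lemma poly_act_mem:
  assumes "vs1.subspace S" "f ` S \<subseteq> S" "v \<in> S"
  shows "poly_act sm p f v \<in> S"
  using assms by (induction p) (auto simp: vs1.subspace_0 intro!: vs1.subspace_add vs1.subspace_scale)

lemma poly_act_dvd: "p dvd q \<Longrightarrow> poly_act sm p f v = 0 \<Longrightarrow> poly_act sm q f v = 0"
  by (metis dvdE mult.commute poly_act_mult linear_poly_act Vector_Spaces.linear.axioms(3) module_hom.zero)

lemma poly_act_monom: "poly_act sm (monom c n) f v = sm c ((f ^^ n) v)"
  by (induction n) (auto simp: monom_0 monom_Suc zero scale)

lemma poly_act_sum: "poly_act sm (sum p A) f v = (\<Sum>i\<in>A. poly_act sm (p i) f v)"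
  by (induction A rule: infinite_finite_induct) (auto simp: poly_act_add)

end

lemma poly_act_pcompose:
  assumes "Vector_Spaces.linear sm sm f"
  shows "poly_act sm (pcompose p q) f v = poly_act sm p (poly_act sm q f) v"
proof (induction p)
  case (pCons a p)
  interpret Vector_Spaces.linear sm sm f by (rule assms)
  show ?case
    using pCons
    by (simp add: pcompose_pCons assms poly_act_add poly_act_mult linear_poly_act zero)
qed simp

text \<open>An intertwining relation passes to polynomials. It serves twice: with \<open>h\<close>
  the involution and \<open>g\<close> the negative of \<open>f\<close>, and with \<open>h\<close> a
  bracket map commuting with \<open>f\<close>.\<close>

lemma poly_act_intertwine:
  assumes f: "linear f" and g: "linear g" and V: "subspace V" "g ` V \<subseteq> V"
    and h: "linear_on V h" "\<And>v. v \<in> V \<Longrightarrow> f (h v) = h (g v)" and v: "v \<in> V"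
  shows "poly_act scaleR p f (h v) = h (poly_act scaleR p g v)"
proof -
  have h0: "h 0 = 0"
    using h(1) V(1) subspace_0[of V] unfolding linear_on_def by (metis scaleR_zero_left)
  note lin = f[unfolded linear_def] g[unfolded linear_def]
  show ?thesis
  proof (induction p)
    case (pCons a p)
    have "poly_act scaleR p g v \<in> V"
      using poly_act_mem[OF lin(2), folded subspace_raw_def, OF V v] .
    then have "a *\<^sub>R v \<in> V" "g (poly_act scaleR p g v) \<in> V" "poly_act scaleR p g v \<in> V"
      using V v by (auto intro: subspace_scale)
    then show ?case
      using pCons h v by (simp add: lin linear_on_def)
  qed (simp add: h0)
qed

text \<open>Induction splits off one simple root z at a time. With g = (X - z) h and h(z) nonzero,
  division of h by X - z expresses \<open>w\<close> through the eigenvector h(F) w and a vector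
  killed by h.\<close>

lemma in_span_eigenvectors:
  fixes sm :: "complex \<Rightarrow> 'w::ab_group_add \<Rightarrow> 'w"
  assumes lin: "Vector_Spaces.linear sm sm F"
    and W: "module.subspace sm W" "F ` W \<subseteq> W"
    and "g \<noteq> 0" "\<And>z. poly g z = 0 \<Longrightarrow> poly (pderiv g) z \<noteq> 0"
    and "w \<in> W" "poly_act sm g F w = 0"
  shows "w \<in> module.span sm {w \<in> W. \<exists>\<mu>. F w = sm \<mu> w}"
  using assms(4-)
proof (induction "degree g" arbitrary: g w rule: less_induct)
  case less
  interpret Vector_Spaces.linear sm sm F by (rule lin)
  show ?case
  proof (cases "degree g = 0")
    case True
    then obtain c where "g = [:c:]" by (meson degree_eq_zeroE)
    then have "w = 0" using less.prems by (simp add: lin zero vs1.scale_eq_0_iff)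
    then show ?thesis by (simp add: vs1.span_zero)
  next
    case False
    then have "\<not> constant (poly g)" by (simp add: constant_degree)
    then obtain z where z: "poly g z = 0" using fundamental_theorem_of_algebra by blast
    then obtain h where h: "g = [:- z, 1:] * h" by (metis dvdE poly_eq_0_iff_dvd)
    have h0: "h \<noteq> 0" using h less.prems(1) by auto
    then have deg: "degree h < degree g" unfolding h by (simp add: degree_mult_eq del: mult_pCons_left)
    have g': "pderiv g = h + [:- z, 1:] * pderiv h"
      unfolding h by (simp add: pderiv_mult pderiv_pCons del: mult_pCons_left)
    have hz: "poly h z \<noteq> 0" using less.prems(2)[OF z] unfolding g' by simp
    obtain k where k: "h = [:- z, 1:] * k + [:poly h z:]" by (metis synthetic_div_correct')
    \<comment> \<open>This vector is killed by \<open>h\<close>, because h (X - z) k = k g.\<close>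
    define u where "u = poly_act sm ([:- z, 1:] * k) F w"
    \<comment> \<open>A root of \<open>h\<close> is a root of \<open>g\<close>, and there only the
      term with \<open>pderiv h\<close> survives in the derivative of \<open>g\<close>.\<close>
    have simple: "poly (pderiv h) y \<noteq> 0" if "poly h y = 0" for y
      using less.prems(2)[of y] that unfolding g' by (auto simp: h)
    have "poly_act sm h F u = poly_act sm k F (poly_act sm g F w)"
      unfolding u_def h by (simp only: poly_act_mult[OF lin, symmetric] ac_simps)
    also have "\<dots> = 0"
      using less.prems(4) poly_act_dvd[OF lin] by (metis dvd_triv_right poly_act_mult[OF lin])
    finally have "poly_act sm h F u = 0" .
    moreover have "u \<in> W" unfolding u_def by (rule poly_act_mem[OF lin W less.prems(3)])
    ultimately have u: "u \<in> vs1.span {w \<in> W. \<exists>\<mu>. F w = sm \<mu> w}"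
      using less.hyps[OF deg h0] simple by blast
    define e where "e = poly_act sm h F w"
    have "e \<in> W" unfolding e_def by (rule poly_act_mem[OF lin W less.prems(3)])
    moreover have "F e = sm z e"
    proof -
      have "poly_act sm [:- z, 1:] F e = 0"
        using less.prems(4) unfolding e_def h poly_act_mult[OF lin] by simp
      then show ?thesis by (simp add: lin zero)
    qed
    ultimately have e: "e \<in> vs1.span {w \<in> W. \<exists>\<mu>. F w = sm \<mu> w}"
      by (blast intro: vs1.span_base)
    have "e = u + sm (poly h z) w"
      unfolding e_def u_def by (subst k) (simp add: poly_act_add lin zero del: mult_pCons_left)
    then have "w = sm (inverse (poly h z)) (e - u)" using hz by simp
    then show ?thesis using e u by (metis vs1.span_diff vs1.span_scale)
  qed
qed

section \<open>Real polynomials on the complexification\<close>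

lemma linear_map_prod_cscale:
  assumes "linear f"
  shows "Vector_Spaces.linear cscale cscale (map_prod f f)"
proof -
  interpret linear f by (rule assms)
  show ?thesis
    by unfold_locales (auto simp: cscale_def add diff scale algebra_simps)
qed

lemma poly_act_map_prod:
  assumes "linear f"
  shows "poly_act cscale (map_poly complex_of_real p) (map_prod f f) (u, v)
    = (poly_act scaleR p f u, poly_act scaleR p f v)"
  using assms linear_map_prod_cscale[OF assms] assms[unfolded linear_def]
  by (induction p) (auto simp: map_poly_pCons cscale_def zero_prod_def)

lemma of_real_poly_add:
  "map_poly of_real (p + q) = map_poly of_real p + (map_poly of_real q :: 'a::{real_algebra_1, comm_ring_1} poly)"
  by (simp add: poly_eq_iff coeff_map_poly)

lemma of_real_poly_mult:
  "map_poly of_real (p * q) = map_poly of_real p * (map_poly of_real q :: 'a::{real_algebra_1, comm_ring_1} poly)"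
  by (simp add: poly_eq_iff coeff_map_poly coeff_mult)

lemma of_real_poly_pderiv:
  "map_poly of_real (pderiv p) = pderiv (map_poly of_real p :: 'a::{real_algebra_1, idom} poly)"
  by (simp add: poly_eq_iff coeff_map_poly coeff_pderiv)

text \<open>A Bezout identity for \<open>q\<close> and its derivative survives the passage to
  complex coefficients. So all complex roots of \<open>q\<close> are simple, and eigenvectors span
  the complexification.\<close>

lemma semisimple_on_if_separable:
  fixes q :: "real poly"
  assumes f: "linear f" and V: "subspace V" "f ` V \<subseteq> V"
    and q: "coprime q (pderiv q)" "\<And>v. v \<in> V \<Longrightarrow> poly_act scaleR q f v = 0"
  shows "semisimple_on V f"
proof -
  let ?q = "map_poly complex_of_real q" and ?F = "map_prod f f"
  have lin: "Vector_Spaces.linear cscale cscale ?F" using f by (rule linear_map_prod_cscale)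
  have sub: "cplx.subspace (V \<times> V)"
    unfolding cplx.subspace_def
    using V(1) by (auto simp: cscale_def zero_prod_def subspace_0 intro!: subspace_add subspace_diff subspace_scale)
  have inv: "?F ` (V \<times> V) \<subseteq> V \<times> V" using V(2) by auto
  obtain a b where ab: "a * q + b * pderiv q = 1"
    using q(1) bezout_coefficients_fst_snd[of q "pderiv q"] by (auto simp: coprime_iff_gcd_eq_1)
  have "map_poly complex_of_real (a * q + b * pderiv q) = map_poly complex_of_real 1"
    by (simp only: ab)
  then have "map_poly of_real a * ?q + map_poly of_real b * pderiv ?q = 1"
    by (simp add: of_real_poly_add of_real_poly_mult of_real_poly_pderiv)
  then have simple: "poly (pderiv ?q) z \<noteq> 0" if "poly ?q z = 0" for z
    using that by (metis add.right_neutral mult_zero_right poly_add poly_mult poly_1 zero_neq_one)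
  have "q \<noteq> 0" using q(1) by auto
  then have "?q \<noteq> 0" by (auto simp: poly_eq_iff coeff_map_poly)
  then have "w \<in> cplx.span {w \<in> V \<times> V. \<exists>\<mu>. ?F w = cscale \<mu> w}" if "w \<in> V \<times> V" for w
    using in_span_eigenvectors[OF lin sub inv _ simple that] q(2) that
    by (auto simp: poly_act_map_prod[OF f] zero_prod_def)
  moreover have "cplx.span {w \<in> V \<times> V. \<exists>\<mu>. ?F w = cscale \<mu> w} \<subseteq> V \<times> V"
    by (rule cplx.span_minimal) (use sub in auto)
  ultimately show ?thesis unfolding semisimple_on_def by blast
qed

text \<open>The first \<open>card B + 1\<close> iterates of \<open>v\<close> lie in a span of
  \<open>card B\<close> vectors. A linear relation between them supplies the coefficients of the
  polynomial.\<close>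

lemma annihilating_poly_vector:
  fixes f :: "'v::real_vector \<Rightarrow> 'v"
  assumes f: "linear f" and B: "finite B" "f ` span B \<subseteq> span B" and v: "v \<in> span B"
  obtains p where "p \<noteq> 0" "poly_act scaleR p f v = 0"
proof -
  note lin = f[unfolded linear_def]
  let ?g = "\<lambda>i. (f ^^ i) v"
  have mem: "?g i \<in> span B" for i using v B(2) by (induction i) auto
  show ?thesis
  \<comment> \<open>Repeated iterates are treated apart, since \<open>dependent\<close> concerns the
    set of iterates and does not see repetitions.\<close>
  proof (cases "inj_on ?g {..card B}")
    case False
    then obtain i j where ij: "?g i = ?g j" "i \<noteq> j" by (auto simp: inj_on_def)
    let ?p = "monom 1 i - monom (1::real) j"
    have "coeff ?p i = 1" using ij by simp
    then have "?p \<noteq> 0" by (metis coeff_0 zero_neq_one)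
    moreover have "poly_act scaleR ?p f v = 0"
      using ij by (simp only: diff_conv_add_uminus poly_act_add[OF lin] poly_act_uminus[OF lin] poly_act_monom[OF lin]) simp
    ultimately show ?thesis by (rule that)
  next
    case True
    let ?X = "?g ` {..card B}"
    have "card ?X = Suc (card B)" using True by (simp add: card_image)
    then have "dependent ?X" using independent_span_bound[OF B(1), of ?X] mem by fastforce
    then obtain u where u: "\<exists>x\<in>?X. u x \<noteq> 0" "(\<Sum>x\<in>?X. u x *\<^sub>R x) = 0"
      by (auto simp: dependent_finite)
    let ?p = "\<Sum>i\<le>card B. monom (u (?g i)) i"
    obtain i where i: "i \<le> card B" "u (?g i) \<noteq> 0" using u(1) by auto
    have "coeff ?p i = u (?g i)" using i by (simp add: coeff_sum)
    then have "?p \<noteq> 0" using i by (metis coeff_0)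
    moreover have "poly_act scaleR ?p f v = 0"
      using u(2) True by (simp add: poly_act_sum[OF lin] poly_act_monom[OF lin] sum.reindex)
    ultimately show ?thesis by (rule that)
  qed
qed

text \<open>The annihilators of the finitely many spanning vectors are multiplied together.\<close>

lemma annihilating_poly:
  fixes f :: "'v::real_vector \<Rightarrow> 'v"
  assumes f: "linear f" and B: "finite B" "f ` span B \<subseteq> span B"
  obtains p where "p \<noteq> 0" "\<And>v. v \<in> span B \<Longrightarrow> poly_act scaleR p f v = 0"
proof -
  note lin = f[unfolded linear_def]
  have "\<exists>p. p \<noteq> 0 \<and> (\<forall>v\<in>A. poly_act scaleR p f v = 0)" if "finite A" "A \<subseteq> span B" for A
    using that
  proof (induction A)
    case (insert x A)
    then obtain p where p: "p \<noteq> 0" "\<forall>v\<in>A. poly_act scaleR p f v = 0" by auto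
    obtain r where r: "r \<noteq> 0" "poly_act scaleR r f x = 0"
      using annihilating_poly_vector[OF f B, of x] insert.prems by auto
    have "poly_act scaleR (p * r) f v = 0" if "v \<in> insert x A" for v
      using that p(2) r(2) poly_act_dvd[OF lin] by (metis dvd_triv_left dvd_triv_right insert_iff)
    then show ?case using p(1) r(1) by (intro exI[of _ "p * r"]) simp
  qed (auto intro: exI[of _ 1])
  from this[OF B(1) span_superset] obtain p where
    p: "p \<noteq> 0" "\<forall>v\<in>B. poly_act scaleR p f v = 0" by blast
  have "linear (poly_act scaleR p f)"
    using linear_poly_act[OF lin] by (rule linear.intro)
  then have "poly_act scaleR p f v = 0" if "v \<in> span B" for v
    using linear_eq_0_on_span p(2) that by blast
  then show ?thesis using p(1) that by blast
qed

lemma odd_jordan_chevalley_poly: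
  fixes F :: "'v::real_vector \<Rightarrow> 'v"
  assumes F: "linear F" and B: "finite B" "F ` span B \<subseteq> span B"
  obtains s where "reflect s = - s" "semisimple_on (span B) (poly_act scaleR s F)"
    "nilpotent_on (span B) (\<lambda>v. F v - poly_act scaleR s F v)"
proof -
  note lin = F[unfolded linear_def]
  obtain p0 where p0: "p0 \<noteq> 0" "\<And>v. v \<in> span B \<Longrightarrow> poly_act scaleR p0 F v = 0"
    using annihilating_poly[OF assms] by blast
  \<comment> \<open>Multiplication by the reflection makes the annihilating polynomial even, so that
    its semisimple part can be chosen odd.\<close>
  define p where "p = p0 * reflect p0"
  have "reflect p0 \<noteq> 0" using p0(1) by (metis pcompose_0 reflect_reflect)
  then have "p \<noteq> 0" "reflect p = p" using p0(1) by (simp_all add: p_def pcompose_mult mult.commute)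
  then obtain q n s where s: "coprime q (pderiv q)" "p dvd pcompose q s" "p dvd ([:0, 1:] - s) ^ n"
    "reflect s = - s"
    using odd_semisimple_part_poly by metis
  have p: "poly_act scaleR r F v = 0" if "p dvd r" "v \<in> span B" for r v
    using that p0(2) poly_act_dvd[OF lin] by (metis dvd_mult_left p_def)
  let ?S = "poly_act scaleR s F"
  have S: "linear ?S" using linear_poly_act[OF lin] by (rule linear.intro)
  have inv: "?S ` span B \<subseteq> span B"
    using poly_act_mem[OF lin, folded subspace_raw_def, OF subspace_span B(2)] by blast
  have "semisimple_on (span B) ?S"
    using semisimple_on_if_separable[OF S subspace_span inv s(1)] p[OF s(2)] by (simp add: poly_act_pcompose[OF lin])
  moreover have "nilpotent_on (span B) (\<lambda>v. F v - ?S v)"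
  proof -
    have "poly_act scaleR ([:0, 1:] - s) F = (\<lambda>v. F v - ?S v)"
      by (rule ext) (simp only: diff_conv_add_uminus poly_act_add[OF lin] poly_act_uminus[OF lin],
          simp add: lin linear_0[OF F])
    then show ?thesis
      using p[OF s(3)] by (auto simp: nilpotent_on_def poly_act_power[OF lin])
  qed
  ultimately show ?thesis using that s(4) by blast
qed

lemma semisimple_on_cong:
  assumes "\<And>v. v \<in> V \<Longrightarrow> f v = g v"
  shows "semisimple_on V f \<longleftrightarrow> semisimple_on V g"
proof -
  have "{w \<in> V \<times> V. \<exists>\<mu>. map_prod f f w = cscale \<mu> w} = {w \<in> V \<times> V. \<exists>\<mu>. map_prod g g w = cscale \<mu> w}"
    using assms by auto
  then show ?thesis by (simp add: semisimple_on_def)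
qed

lemma nilpotent_on_cong:
  assumes "\<And>v. v \<in> V \<Longrightarrow> f v = g v" "f ` V \<subseteq> V"
  shows "nilpotent_on V f \<longleftrightarrow> nilpotent_on V g"
proof -
  have "(f ^^ n) v \<in> V \<and> (f ^^ n) v = (g ^^ n) v" if "v \<in> V" for n v
    using assms that by (induction n) auto
  then show ?thesis by (simp add: nilpotent_on_def)
qed

section \<open>Linear maps and pairings on subspaces\<close>

lemma
  assumes "linear_on V f" "subspace V"
  shows linear_on_0: "f 0 = 0"
    and linear_on_add: "x \<in> V \<Longrightarrow> y \<in> V \<Longrightarrow> f (x + y) = f x + f y"
    and linear_on_scaleR: "x \<in> V \<Longrightarrow> f (c *\<^sub>R x) = c *\<^sub>R f x"
    and linear_on_minus: "x \<in> V \<Longrightarrow> f (- x) = - f x"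
    and linear_on_diff: "x \<in> V \<Longrightarrow> y \<in> V \<Longrightarrow> f (x - y) = f x - f y"
proof -
  show add: "f (x + y) = f x + f y" if "x \<in> V" "y \<in> V" for x y
    using assms(1) that by (simp add: linear_on_def)
  show sc: "f (c *\<^sub>R x) = c *\<^sub>R f x" if "x \<in> V" for x c
    using assms(1) that by (simp add: linear_on_def)
  show "f 0 = 0" using sc[of 0 0] assms(2) by (simp add: subspace_0)
  show neg: "f (- x) = - f x" if "x \<in> V" for x
    using sc[of x "-1"] that by simp
  show "f (x - y) = f x - f y" if "x \<in> V" "y \<in> V" for x y
    using add[of x "- y"] neg that assms(2) by (simp add: subspace_neg)
qed

lemma linear_on_sum:
  assumes "linear_on V f" "subspace V" "\<And>i. i \<in> I \<Longrightarrow> x i \<in> V"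
  shows "f (\<Sum>i\<in>I. x i) = (\<Sum>i\<in>I. f (x i))"
  using assms(3)
proof (induction I rule: infinite_finite_induct)
  case (insert i I)
  then show ?case
    by (simp add: linear_on_add[OF assms(1,2)] subspace_sum[OF assms(2)])
qed (auto simp: linear_on_0[OF assms(1,2)])

lemma linear_on_subset: "linear_on V f \<Longrightarrow> W \<subseteq> V \<Longrightarrow> linear_on W f"
  unfolding linear_on_def by blast

text \<open>Bracket maps are linear only on the carrier, whereas polynomials are evaluated at total
  linear maps. The extension bridges the two.\<close>

lemma linear_on_extend:
  assumes f: "linear_on V f" and V: "subspace V"
  obtains F where "linear F" "\<And>v. v \<in> V \<Longrightarrow> F v = f v"
proof -
  obtain B where B: "B \<subseteq> V" "independent B" "V \<subseteq> span B"
    by (rule maximal_independent_subset)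
  obtain F where F: "linear F" "\<forall>v\<in>B. F v = f v"
    using linear_independent_extend[OF B(2)] by blast
  have "subspace {v \<in> V. F v = f v}"
    using V f F(1) unfolding subspace_def
    by (auto simp: linear_on_0[OF f V] linear_on_def linear_0 linear_add linear_cmul)
  then have "span B \<subseteq> {v \<in> V. F v = f v}"
    using B(1) F(2) by (intro span_minimal) auto
  then have "F v = f v" if "v \<in> V" for v
    using that B(3) by auto
  with F(1) show ?thesis by (rule that)
qed

text \<open>The values of \<beta> u on a basis can be prescribed one basis vector at a time, because
  \<beta> separates the points of \<open>V\<close>.\<close>

lemma separating_pairing_represents:
  fixes \<beta> :: "'u::real_vector \<Rightarrow> 'v::real_vector \<Rightarrow> real"
  assumes U: "subspace U" and V: "subspace V"
    and \<beta>1: "\<And>v. v \<in> V \<Longrightarrow> linear_on U (\<lambda>u. \<beta> u v)" and \<beta>2: "\<And>u. u \<in> U \<Longrightarrow> linear_on V (\<beta> u)"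
    and sep: "\<And>v. v \<in> V \<Longrightarrow> (\<And>u. u \<in> U \<Longrightarrow> \<beta> u v = 0) \<Longrightarrow> v = 0"
    and B: "finite B" "independent B" "span B = V" and l: "linear_on V l"
  shows "\<exists>u\<in>U. \<forall>v\<in>V. \<beta> u v = l v"
proof -
  have interpolate: "\<exists>u\<in>U. \<forall>b\<in>C. \<beta> u b = m b" if "finite C" "C \<subseteq> B" for C and m :: "'v \<Rightarrow> real"
    using that
  proof (induction C arbitrary: m)
    case (insert b C)
    then have CV: "C \<subseteq> V" and b: "b \<in> V" using B(3) span_superset[of B] insert.prems by auto
    \<comment> \<open>The vector \<open>e\<close> allows the value at \<open>b\<close> to be changed
      without disturbing those on \<open>C\<close>. If there were none, \<open>b\<close> would lie
      in the span of \<open>C\<close>.\<close>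
    have "\<exists>e\<in>U. (\<forall>c\<in>C. \<beta> e c = 0) \<and> \<beta> e b \<noteq> 0"
    proof (rule ccontr)
      assume "\<not> ?thesis"
      then have vanish: "\<beta> e b = 0" if "e \<in> U" "\<And>c. c \<in> C \<Longrightarrow> \<beta> e c = 0" for e
        using that by blast
      have "\<exists>d\<in>U. \<forall>c\<in>C. \<beta> d c = (if c = c' then 1 else 0)" for c'
        using insert.IH[of "\<lambda>c. if c = c' then 1 else 0"] insert.prems by auto
      then obtain d where d: "\<And>c'. d c' \<in> U" "\<And>c c'. c \<in> C \<Longrightarrow> \<beta> (d c') c = (if c = c' then 1 else 0)"
        by metis
      \<comment> \<open>The vectors \<open>d c\<close> are dual to \<open>C\<close>, so the sum is
        the only possible expansion of \<open>b\<close> in \<open>C\<close>.\<close>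
      define w where "w = b - (\<Sum>c\<in>C. \<beta> (d c) b *\<^sub>R c)"
      have mem: "\<beta> (d c) b *\<^sub>R c \<in> V" if "c \<in> C" for c
        using that CV V by (auto intro: subspace_scale)
      have "w \<in> V" unfolding w_def using b V mem by (auto intro!: subspace_diff subspace_sum)
      moreover have "\<beta> u w = 0" if u: "u \<in> U" for u
      proof -
        \<comment> \<open>This \<open>e\<close> vanishes on \<open>C\<close>, hence also at
          \<open>b\<close>; that equation is \<beta> u w = 0.\<close>
        define e where "e = u - (\<Sum>c\<in>C. \<beta> u c *\<^sub>R d c)"
        have mem': "\<beta> u c *\<^sub>R d c \<in> U" for c using d(1) U by (auto intro: subspace_scale)
        have e: "\<beta> e v = \<beta> u v - (\<Sum>c\<in>C. \<beta> u c * \<beta> (d c) v)" if "v \<in> V" for v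
          using u d(1) U mem' unfolding e_def
          by (simp add: linear_on_diff[OF \<beta>1[OF that] U] linear_on_sum[OF \<beta>1[OF that] U]
              linear_on_scaleR[OF \<beta>1[OF that] U] subspace_sum)
        have "e \<in> U" unfolding e_def using u mem' U by (auto intro!: subspace_diff subspace_sum)
        moreover have "\<beta> e c = 0" if "c \<in> C" for c
          using that CV \<open>finite C\<close> by (subst e) (auto simp: d(2) if_distrib sum.delta cong: if_cong)
        ultimately have "\<beta> e b = 0" by (rule vanish)
        moreover have "\<beta> u w = \<beta> u b - (\<Sum>c\<in>C. \<beta> u c * \<beta> (d c) b)"
        proof -
          have "\<beta> u (\<Sum>c\<in>C. \<beta> (d c) b *\<^sub>R c) = (\<Sum>c\<in>C. \<beta> u c * \<beta> (d c) b)"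
            using CV by (subst linear_on_sum[OF \<beta>2[OF u] V mem])
              (auto simp: linear_on_scaleR[OF \<beta>2[OF u] V] mult.commute intro!: sum.cong)
          then show ?thesis
            unfolding w_def using b mem V by (simp add: linear_on_diff[OF \<beta>2[OF u] V] subspace_sum)
        qed
        ultimately show ?thesis using e[OF b] by simp
      qed
      ultimately have "w = 0" by (rule sep)
      then have "b = (\<Sum>c\<in>C. \<beta> (d c) b *\<^sub>R c)" by (simp add: w_def)
      moreover have "(\<Sum>c\<in>C. \<beta> (d c) b *\<^sub>R c) \<in> span C"
        by (intro span_sum span_scale span_base)
      ultimately have "b \<in> span C" by (rule ssubst[where P = "\<lambda>x. x \<in> span C"])
      moreover have "independent (insert b C)" using independent_mono[OF B(2)] insert.prems by blast
      ultimately show False using insert.hyps(2) by (simp add: independent_insert)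
    qed
    then obtain e where e: "e \<in> U" "\<And>c. c \<in> C \<Longrightarrow> \<beta> e c = 0" "\<beta> e b \<noteq> 0" by blast
    obtain u where u: "u \<in> U" "\<And>c. c \<in> C \<Longrightarrow> \<beta> u c = m c" using insert by blast
    define t where "t = (m b - \<beta> u b) / \<beta> e b"
    have "\<beta> (u + t *\<^sub>R e) v = \<beta> u v + t * \<beta> e v" if "v \<in> V" for v
      using linear_on_add[OF \<beta>1[OF that] U] linear_on_scaleR[OF \<beta>1[OF that] U] u(1) e(1) U
      by (simp add: subspace_scale)
    then have "\<beta> (u + t *\<^sub>R e) c = m c" if "c \<in> insert b C" for c
      using that b CV u e by (auto simp: t_def)
    then show ?case using u(1) e(1) U by (metis subspace_add subspace_scale)
  qed (use U subspace_0 in auto)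
  obtain u where u: "u \<in> U" "\<forall>b\<in>B. \<beta> u b = l b" using interpolate[OF B(1) order_refl] by blast
  note lu = \<beta>2[OF u(1)]
  have "subspace {v \<in> V. \<beta> u v = l v}"
    using V unfolding subspace_def
    by (auto simp: linear_on_0[OF l V] linear_on_0[OF lu V] linear_on_add[OF l V] linear_on_add[OF lu V]
        linear_on_scaleR[OF l V] linear_on_scaleR[OF lu V])
  then have "span B \<subseteq> {v \<in> V. \<beta> u v = l v}"
    using B(3) u(2) span_superset by (intro span_minimal) auto
  then show ?thesis using u(1) B(3) by blast
qed

lemma subspace_finite_basis:
  assumes "subspace W" "W \<subseteq> span B" "finite B"
  obtains C where "finite C" "independent C" "span C = W"
proof -
  obtain C where C: "C \<subseteq> W" "independent C" "W \<subseteq> span C"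
    by (rule maximal_independent_subset)
  then have "finite C" using independent_span_bound[OF assms(3)] assms(2) by (meson subset_trans)
  moreover have "span C = W" using C assms(1) by (simp add: span_minimal subset_antisym)
  ultimately show ?thesis using that C(2) by blast
qed

section \<open>Every elementary solvable exact triple is standard\<close>

text \<open>In a symplectic triple only 0 acts trivially on \<P>, so \<open>z\<close> can be nonzero
  only in the central extension, as a multiple of E. Then \<xi> would vanish on E, and its
  restriction would exhibit the cocycle being extended by as a coboundary.\<close>

lemma associated_triple_faithful:
  assumes inv: "involutive_automorphism T" and lie: "lie_algebra T"
    and assoc: "associated_to_symplectic_symmetric_space T"
    and \<xi>: "linear_on (carr T) \<xi>" "\<And>x y. x \<in> carr T \<Longrightarrow> y \<in> carr T \<Longrightarrow> form T x y = \<xi> (brk T x y)"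
    and z: "z \<in> K_space T" "\<And>p. p \<in> P_space T \<Longrightarrow> brk T z p = 0" "\<xi> z = 0"
  shows "z = 0"
proof -
  obtain T0 :: "'a triple" where T0: "symplectic_triple T0" "associated_exact_triple T0 T"
    using assoc unfolding associated_to_symplectic_symmetric_space_def by blast
  have V: "subspace (carr T)" using lie by (simp add: lie_algebra_def)
  have zV: "z \<in> carr T" using z(1) by (simp add: K_space_def)
  have P_lift: "\<exists>p\<in>P_space T. j p = p'"
    if j: "triple_hom T T' j" "bij_betw j (carr T) (carr T')" and p': "p' \<in> P_space T'"
    for T' :: "'w::real_vector triple" and j p'
  proof -
    obtain p where p: "p \<in> carr T" "j p = p'"
      using p' bij_betw_imp_surj_on[OF j(2)] by (force simp: P_space_def)
    have lin: "linear_on (carr T) j" using j(1) by (simp add: triple_hom_def)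
    have "invol T' (j p) = j (invol T p)" using j(1) p(1) by (simp add: triple_hom_def)
    then have "j (invol T p) = j (- p)"
      using p p' by (simp add: P_space_def linear_on_minus[OF lin V])
    moreover have "invol T p \<in> carr T" "- p \<in> carr T"
      using inv p V by (auto simp: involutive_automorphism_def subspace_neg)
    ultimately have "invol T p = - p"
      using j(2) by (meson bij_betw_imp_inj_on inj_onD)
    then show ?thesis using p by (auto simp: P_space_def)
  qed
  have zero_lift: "j z \<in> K_space T'" "\<And>p'. p' \<in> P_space T' \<Longrightarrow> brk T' (j z) p' = 0" "j z = 0 \<Longrightarrow> z = 0"
    if j: "triple_hom T T' j" "bij_betw j (carr T) (carr T')"
    for T' :: "'w::real_vector triple" and j
  proof -
    have lin: "linear_on (carr T) j" using j(1) by (simp add: triple_hom_def)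
    show "j z \<in> K_space T'"
      using j(1) z(1) by (auto simp: triple_hom_def K_space_def)
    show "brk T' (j z) p' = 0" if p': "p' \<in> P_space T'" for p'
    proof -
      obtain p where p: "p \<in> P_space T" "j p = p'" using P_lift[OF j p'] by blast
      then have "brk T' (j z) p' = j (brk T z p)"
        using j(1) zV by (auto simp: triple_hom_def P_space_def)
      then show ?thesis using z(2) p(1) by (simp add: linear_on_0[OF lin V])
    qed
    show "z = 0" if "j z = 0"
      using that j(2) zV V linear_on_0[OF lin V] by (metis bij_betw_imp_inj_on inj_onD subspace_0)
  qed
  show ?thesis
  proof (cases "chevalley_coboundary T0")
    case True
    then obtain j where j: "triple_hom T T0 j" "bij_betw j (carr T) (carr T0)"
      using T0(2) by (auto simp: associated_exact_triple_def isomorphic_triples_def)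
    have "j z = 0"
      using T0(1) zero_lift[OF j] by (auto simp: symplectic_triple_def K_faithful_on_P_def)
    then show ?thesis using zero_lift(3)[OF j] by blast
  next
    case False
    let ?E = "central_extension T0"
    from False obtain j where j: "triple_hom T ?E j" "bij_betw j (carr T) (carr ?E)"
      using T0(2) by (auto simp: associated_exact_triple_def isomorphic_triples_def)
    have lin: "linear_on (carr T) j" using j(1) by (simp add: triple_hom_def)
    obtain k t where kt: "j z = (k, t)" by fastforce
    have "k \<in> K_space T0"
      using zero_lift(1)[OF j] kt by (simp add: K_space_def central_extension_def)
    moreover have "brk T0 k p = 0" if "p \<in> P_space T0" for p
      \<comment> \<open>The involution fixes the central coordinate, so odd elements of the
        extension have central coordinate 0.\<close>
      using zero_lift(2)[OF j, of "(p, 0)"] that kt by (simp add: P_space_def central_extension_def zero_prod_def)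
    ultimately have k: "k = 0"
      using T0(1) unfolding symplectic_triple_def K_faithful_on_P_def by blast
    have "t = 0"
    proof (rule ccontr)
      assume t: "t \<noteq> 0"
      define i where "i = inv_into (carr T) j"
      have i: "i w \<in> carr T" "j (i w) = w" if "w \<in> carr ?E" for w
        using that inv_into_into[of w j "carr T"] f_inv_into_f[of w j "carr T"] bij_betw_imp_surj_on[OF j(2)]
        by (simp_all add: i_def)
      have ij: "i (j x) = x" if "x \<in> carr T" for x
        using that j(2) by (simp add: i_def bij_betw_def)
      have E: "(x, r) \<in> carr ?E" if "x \<in> carr T0" for x r
        using that by (simp add: central_extension_def)
      have i_add: "i (v + w) = i v + i w" if "v \<in> carr ?E" "w \<in> carr ?E" for v w
        using ij[of "i v + i w"] i that V by (simp add: linear_on_add[OF lin V] subspace_add)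
      have i_scale: "i (c *\<^sub>R w) = c *\<^sub>R i w" if "w \<in> carr ?E" for c w
        using ij[of "c *\<^sub>R i w"] i that V by (simp add: linear_on_scaleR[OF lin V] subspace_scale)
      \<comment> \<open>The pull-back of \<xi> along the section x \<mapsto> (x, 0); it will be a
        primitive of \<open>form T0\<close>.\<close>
      define \<eta> where "\<eta> x = \<xi> (i (x, 0))" for x
      have "linear_on (carr T0) \<eta>"
        unfolding linear_on_def \<eta>_def
        using i_add[OF E E, of _ _ 0 0] i_scale[OF E, of _ _ 0] i(1) E
        by (simp add: linear_on_add[OF \<xi>(1) V] linear_on_scaleR[OF \<xi>(1) V])
      moreover have "form T0 x y = \<eta> (brk T0 x y)" if xy: "x \<in> carr T0" "y \<in> carr T0" for x y
      proof -
        have lie0: "lie_algebra T0" using T0(1) by (simp add: symplectic_triple_def)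
        then have b: "brk T0 x y \<in> carr T0" and z0: "0 \<in> carr T0"
          using xy by (auto simp: lie_algebra_def subspace_0)
        let ?x = "i (x, 0)" and ?y = "i (y, 0)"
        have "form T0 x y = form ?E (j ?x) (j ?y)"
          using i E xy by (simp add: central_extension_def)
        also have "\<dots> = form T ?x ?y" using j(1) i(1) E xy by (simp add: triple_hom_def)
        also have "\<dots> = \<xi> (brk T ?x ?y)" using \<xi>(2) i(1) E xy by simp
        also have "brk T ?x ?y = i (j (brk T ?x ?y))"
          using ij lie i(1) E xy by (simp add: lie_algebra_def)
        also have "j (brk T ?x ?y) = brk ?E (x, 0) (y, 0)"
          using j(1) i E xy by (simp add: triple_hom_def)
        \<comment> \<open>The central part is written as a multiple of (0, t), the image of
          \<open>z\<close>, so that \<xi> annihilates it.\<close>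
        also have "\<dots> = (brk T0 x y, 0) + (form T0 x y / t) *\<^sub>R (0, t)"
          using t by (simp add: central_extension_def)
        also have "i \<dots> = i (brk T0 x y, 0) + (form T0 x y / t) *\<^sub>R z"
        proof -
          have "i (0, t) = z" using ij[OF zV] kt k by simp
          moreover have "(form T0 x y / t) *\<^sub>R (0, t) \<in> carr ?E" using z0 by (simp add: central_extension_def)
          ultimately show ?thesis
            using i_add[OF E[OF b]] i_scale[OF E[OF z0]] by metis
        qed
        also have "\<xi> \<dots> = \<eta> (brk T0 x y)"
          using i(1)[OF E[OF b]] zV V z(3)
          by (simp add: \<eta>_def linear_on_add[OF \<xi>(1) V] linear_on_scaleR[OF \<xi>(1) V] subspace_scale)
        finally show ?thesis .
      qed
      ultimately show False using False by (auto simp: chevalley_coboundary_def)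
    qed
    then show ?thesis using zero_lift(3)[OF j] kt k by (simp add: zero_prod_def)
  qed
qed

lemma split_abelian_extension_subset:
  assumes "split_abelian_extension T \<bb> \<aa>"
  shows "\<bb> \<subseteq> carr T" "\<aa> \<subseteq> carr T"
proof -
  from assms have 0: "0 \<in> \<bb>" "0 \<in> \<aa>"
    and V: "carr T = {x + y | x y. x \<in> \<bb> \<and> y \<in> \<aa>}"
    by (simp_all add: split_abelian_extension_def subspace_0)
  show "\<bb> \<subseteq> carr T"
  proof
    fix x assume "x \<in> \<bb>"
    then have "x + 0 \<in> carr T" using 0 unfolding V by blast
    then show "x \<in> carr T" by simp
  qed
  show "\<aa> \<subseteq> carr T"
  proof
    fix x assume "x \<in> \<aa>"
    then have "0 + x \<in> carr T" using 0 unfolding V by blast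
    then show "x \<in> carr T" by simp
  qed
qed

lemma ESET_imp_standard_ESET:
  assumes eset: "ESET T \<bb> \<aa>"
  shows "standard_ESET T \<bb> \<aa>"
proof -
  let ?V = "carr T" and ?\<sigma> = "invol T"
  from eset have lie: "lie_algebra T" and inv: "involutive_automorphism T" and gen: "PP_generates_K T"
    and nondeg: "nondegenerate_on_P T" and assoc: "associated_to_symplectic_symmetric_space T"
    and split: "split_abelian_extension T \<bb> \<aa>" and \<sigma>b: "?\<sigma> ` \<bb> \<subseteq> \<bb>" and \<sigma>a: "?\<sigma> ` \<aa> \<subseteq> \<aa>"
    and cob: "chevalley_coboundary T"
    by (simp_all add: ESET_def exact_triple_def)
  from cob obtain \<xi> where \<xi>: "linear_on ?V \<xi>" "\<And>x y. x \<in> ?V \<Longrightarrow> y \<in> ?V \<Longrightarrow> form T x y = \<xi> (brk T x y)"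
    by (auto simp: chevalley_coboundary_def)
  from lie obtain B where V: "subspace ?V" and B: "finite B" "?V = span B"
    and closed: "\<And>x y. x \<in> ?V \<Longrightarrow> y \<in> ?V \<Longrightarrow> brk T x y \<in> ?V"
    and brk_right: "\<And>x. x \<in> ?V \<Longrightarrow> linear_on ?V (brk T x)"
    and brk_left: "\<And>y. y \<in> ?V \<Longrightarrow> linear_on ?V (\<lambda>x. brk T x y)"
    and alt: "\<And>x. x \<in> ?V \<Longrightarrow> brk T x x = 0"
    and jacobi: "\<And>x y z. x \<in> ?V \<Longrightarrow> y \<in> ?V \<Longrightarrow> z \<in> ?V \<Longrightarrow>
        brk T x (brk T y z) + brk T y (brk T z x) + brk T z (brk T x y) = 0"
    by (auto simp: lie_algebra_def bilinear_on_def)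
  from inv have \<sigma>: "linear_on ?V ?\<sigma>" "\<And>x. x \<in> ?V \<Longrightarrow> ?\<sigma> x \<in> ?V" "\<And>x. x \<in> ?V \<Longrightarrow> ?\<sigma> (?\<sigma> x) = x"
    "\<And>x y. x \<in> ?V \<Longrightarrow> y \<in> ?V \<Longrightarrow> ?\<sigma> (brk T x y) = brk T (?\<sigma> x) (?\<sigma> y)"
    by (auto simp: involutive_automorphism_def)
  from split have b: "subspace \<bb>" and a: "subspace \<aa>" and ba: "\<bb> \<inter> \<aa> = {0}"
    and V_eq: "?V = {x + y | x y. x \<in> \<bb> \<and> y \<in> \<aa>}"
    and ideal: "\<And>x y. x \<in> ?V \<Longrightarrow> y \<in> \<bb> \<Longrightarrow> brk T x y \<in> \<bb>"
    and bb: "\<And>x y. x \<in> \<bb> \<Longrightarrow> y \<in> \<bb> \<Longrightarrow> brk T x y = 0"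
    and aa: "\<And>x y. x \<in> \<aa> \<Longrightarrow> y \<in> \<aa> \<Longrightarrow> brk T x y = 0"
    by (auto simp: split_abelian_extension_def)
  note bV = split_abelian_extension_subset(1)[OF split] and aV = split_abelian_extension_subset(2)[OF split]
  have decomp: "\<exists>x1\<in>\<bb>. \<exists>x2\<in>\<aa>. x = x1 + x2" if "x \<in> ?V" for x
    using that unfolding V_eq by blast
  have skew: "brk T x y = - brk T y x" if x: "x \<in> ?V" and y: "y \<in> ?V" for x y
  proof -
    have "brk T (x + y) (x + y) = 0" using alt V x y by (simp add: subspace_add)
    then have "brk T x y + brk T y x = 0"
      using V x y alt[OF x] alt[OF y]
      by (simp add: linear_on_add[OF brk_left V] linear_on_add[OF brk_right V] subspace_add add.commute)
    then show ?thesis by (simp add: eq_neg_iff_add_eq_0 add.commute)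
  qed
  \<comment> \<open>The derived algebra lies in \<bb>, because the only bracket outside the ideal
    would be one of two elements of \<aa>, and these commute.\<close>
  have brk_b: "brk T x y \<in> \<bb>" if xV: "x \<in> ?V" and yV: "y \<in> ?V" for x y
  proof -
    obtain x1 x2 y1 y2 where x: "x = x1 + x2" "x1 \<in> \<bb>" "x2 \<in> \<aa>" and y: "y = y1 + y2" "y1 \<in> \<bb>" "y2 \<in> \<aa>"
      using decomp[OF xV] decomp[OF yV] by blast
    have mem: "x1 \<in> ?V" "x2 \<in> ?V" "y1 \<in> ?V" "y2 \<in> ?V" using x y aV bV by auto
    have "brk T x y = brk T x y1 + brk T x1 y2 + brk T x2 y2"
      using xV yV x(1) y(1) mem by (simp add: linear_on_add[OF brk_left V] linear_on_add[OF brk_right V])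
    also have "\<dots> = brk T x y1 - brk T y2 x1"
      using aa[OF x(3) y(3)] skew[OF mem(1,4)] by simp
    finally show ?thesis using ideal xV x y mem b by (simp add: subspace_diff)
  qed
  have Kb: "K_space T \<subseteq> \<bb>"
    unfolding gen[unfolded PP_generates_K_def, symmetric]
    by (rule span_minimal) (auto simp: P_space_def intro: brk_b b)
  have \<sigma>_a: "?\<sigma> x = - x" if "x \<in> \<aa>" for x
  proof -
    have x: "x \<in> ?V" using that aV by auto
    \<comment> \<open>This sum is even, hence in \<bb>, and it also lies in \<aa>, so it is
      0.\<close>
    have "?\<sigma> (x + ?\<sigma> x) = x + ?\<sigma> x"
      using x \<sigma> by (simp add: linear_on_add[OF \<sigma>(1) V])
    then have "x + ?\<sigma> x \<in> K_space T" using x \<sigma> V by (simp add: K_space_def subspace_add)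
    moreover have "x + ?\<sigma> x \<in> \<aa>" using that \<sigma>a a by (auto intro: subspace_add)
    ultimately have "x + ?\<sigma> x = 0" using Kb ba by blast
    then show ?thesis by (simp add: add_eq_0_iff)
  qed
  define W where "W = {v \<in> \<bb>. ?\<sigma> v = - v}"
  have WV: "W \<subseteq> ?V" using bV by (auto simp: W_def)
  have W: "subspace W"
    using b bV unfolding subspace_def W_def
    by (auto simp: linear_on_0[OF \<sigma>(1) V] linear_on_add[OF \<sigma>(1) V] linear_on_scaleR[OF \<sigma>(1) V] subset_iff)
  obtain B\<^sub>b where Bb: "finite B\<^sub>b" "span B\<^sub>b = \<bb>"
    using subspace_finite_basis[OF b _ B(1)] bV B(2) by metis
  obtain B\<^sub>W where BW: "finite B\<^sub>W" "independent B\<^sub>W" "span B\<^sub>W = W"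
    using subspace_finite_basis[OF W _ B(1)] WV B(2) by metis
  \<comment> \<open>For \<open>v\<close> in \<bb> only the \<aa>-component of the second argument
    contributes to the form, so nondegeneracy on \<P> reduces to the pairing with \<aa>.\<close>
  have sep: "v = 0" if v: "v \<in> W" and 0: "\<And>u. u \<in> \<aa> \<Longrightarrow> \<xi> (brk T u v) = 0" for v
  proof -
    have vV: "v \<in> ?V" using v WV by auto
    have "form T v y = 0" if yV: "y \<in> ?V" for y
    proof -
      obtain y1 y2 where y: "y = y1 + y2" "y1 \<in> \<bb>" "y2 \<in> \<aa>" using decomp[OF yV] by blast
      have mem: "y1 \<in> ?V" "y2 \<in> ?V" using y aV bV by auto
      have "brk T v y = brk T v y1 + brk T v y2"
        using vV mem y(1) by (simp add: linear_on_add[OF brk_right V])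
      also have "\<dots> = - brk T y2 v" using v y(2) bb skew[OF vV mem(2)] by (simp add: W_def)
      finally show ?thesis
        using vV yV mem 0 y(3) closed by (simp add: \<xi>(2) linear_on_minus[OF \<xi>(1) V])
    qed
    moreover have "v \<in> P_space T" using v vV by (simp add: W_def P_space_def)
    ultimately show ?thesis using nondeg unfolding nondegenerate_on_P_def P_space_def by blast
  qed
  have "\<exists>a\<^sub>N\<in>\<aa>. \<exists>a\<^sub>S\<in>\<aa>. jordan_chevalley \<bb> (brk T x) (brk T a\<^sub>N) (brk T a\<^sub>S)" if x: "x \<in> \<aa>" for x
  proof -
    have xV: "x \<in> ?V" using x aV by auto
    obtain F where F: "linear F" "\<And>v. v \<in> \<bb> \<Longrightarrow> F v = brk T x v"
      using linear_on_extend[OF linear_on_subset[OF brk_right[OF xV] bV] b] by blast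
    note lin = F(1)[unfolded linear_def]
    have Fb: "F ` \<bb> \<subseteq> \<bb>" by (rule image_subsetI) (simp add: F(2) ideal xV)
    obtain s where s: "reflect s = - s" "semisimple_on \<bb> (poly_act scaleR s F)"
      "nilpotent_on \<bb> (\<lambda>v. F v - poly_act scaleR s F v)"
      using odd_jordan_chevalley_poly[OF F(1) Bb(1)] Fb Bb(2) by metis
    define S where "S = poly_act scaleR s F"
    have S: "linear S" unfolding S_def using linear_poly_act[OF lin] by (rule linear.intro)
    have Sb: "S v \<in> \<bb>" if "v \<in> \<bb>" for v
      using poly_act_mem[OF lin, folded subspace_raw_def, OF b Fb that] by (simp add: S_def)
    \<comment> \<open>As the involution negates \<open>x\<close>, it intertwines \<open>F\<close>
      with -F; since \<open>s\<close> is odd, evaluating it at -F gives -S.\<close>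
    have S\<sigma>: "S (?\<sigma> v) = - ?\<sigma> (S v)" if v: "v \<in> \<bb>" for v
    proof -
      let ?G = "\<lambda>v. - F v"
      have G: "linear ?G" using F(1) by (rule linear_compose_neg)
      have "F (?\<sigma> v) = ?\<sigma> (?G v)" if v: "v \<in> \<bb>" for v
      proof -
        have vV: "v \<in> ?V" using v bV by auto
        have "F (?\<sigma> v) = brk T x (?\<sigma> v)" using F(2) v \<sigma>b by auto
        also have "\<dots> = ?\<sigma> (brk T (?\<sigma> x) v)" using \<sigma>(2-4) xV vV by simp
        also have "brk T (?\<sigma> x) v = - brk T x v"
          using \<sigma>_a[OF x] by (simp add: linear_on_minus[OF brk_left[OF vV] V xV])
        finally show ?thesis using F(2) v by simp
      qed
      moreover have "?G ` \<bb> \<subseteq> \<bb>" using Fb b by (auto intro: subspace_neg)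
      ultimately have "S (?\<sigma> v) = ?\<sigma> (poly_act scaleR s ?G v)"
        unfolding S_def using poly_act_intertwine[OF F(1) G b _ linear_on_subset[OF \<sigma>(1) bV]] v by blast
      also have "poly_act scaleR s ?G = poly_act scaleR (reflect s) F"
      proof -
        have "poly_act scaleR [:0, -1:] F = ?G"
          by (rule ext) (simp add: lin linear_0[OF F(1)] linear_neg[OF F(1)])
        then show ?thesis by (intro ext) (simp only: poly_act_pcompose[OF lin])
      qed
      also have "\<dots> = (\<lambda>v. - S v)" by (rule ext) (simp add: s(1) S_def poly_act_uminus[OF lin])
      finally show ?thesis using Sb[OF v] bV by (simp add: linear_on_minus[OF \<sigma>(1) V] subset_iff)
    qed
    \<comment> \<open>Jacobi and commutativity of \<aa> make the bracket with \<open>y\<close>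
      commute with \<open>F\<close>, hence with any polynomial in it.\<close>
    have S_ad: "S (brk T y v) = brk T y (S v)" if y: "y \<in> \<aa>" and v: "v \<in> \<bb>" for y v
    proof -
      have yV: "y \<in> ?V" using y aV by auto
      have "F (brk T y v) = brk T y (F v)" if v: "v \<in> \<bb>" for v
      proof -
        have vV: "v \<in> ?V" using v bV by auto
        have "brk T y (brk T v x) = - brk T y (brk T x v)"
          using skew[OF vV xV] closed[OF xV vV] by (simp add: linear_on_minus[OF brk_right[OF yV] V])
        moreover have "brk T v (brk T x y) = 0"
          using aa[OF x y] by (simp add: linear_on_0[OF brk_right[OF vV] V])
        ultimately have "brk T x (brk T y v) = brk T y (brk T x v)"
          using jacobi[OF xV yV vV] by simp
        then show ?thesis using F(2) v ideal[OF yV v] by simp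
      qed
      then show ?thesis
        unfolding S_def
        using poly_act_intertwine[OF F(1) F(1) b Fb linear_on_subset[OF brk_right[OF yV] bV]] v by blast
    qed
    have lin_S: "linear_on W (\<lambda>v. \<xi> (S v))"
    proof -
      have "S v \<in> ?V" if "v \<in> W" for v using that Sb bV by (auto simp: W_def)
      then show ?thesis
        using linear_add[OF S] linear_cmul[OF S]
        by (simp add: linear_on_def linear_on_add[OF \<xi>(1) V] linear_on_scaleR[OF \<xi>(1) V])
    qed
    have lin_left: "linear_on \<aa> (\<lambda>u. \<xi> (brk T u v))" if "v \<in> W" for v
    proof -
      have vV: "v \<in> ?V" using that WV by auto
      show ?thesis
        unfolding linear_on_def using vV aV closed
        by (auto simp: subset_iff linear_on_add[OF brk_left V] linear_on_scaleR[OF brk_left V]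
            linear_on_add[OF \<xi>(1) V] linear_on_scaleR[OF \<xi>(1) V])
    qed
    have lin_right: "linear_on W (\<lambda>v. \<xi> (brk T u v))" if "u \<in> \<aa>" for u
    proof -
      have uV: "u \<in> ?V" using that aV by auto
      show ?thesis
        unfolding linear_on_def using uV WV closed
        by (auto simp: subset_iff linear_on_add[OF brk_right V] linear_on_scaleR[OF brk_right V]
            linear_on_add[OF \<xi>(1) V] linear_on_scaleR[OF \<xi>(1) V])
    qed
    obtain y where y: "y \<in> \<aa>" "\<And>v. v \<in> W \<Longrightarrow> \<xi> (brk T y v) = \<xi> (S v)"
      using separating_pairing_represents[where \<beta> = "\<lambda>u v. \<xi> (brk T u v)",
          OF a W lin_left lin_right sep BW lin_S] by blast
    have yV: "y \<in> ?V" using y aV by auto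
    define D where "D v = S v - brk T y v" for v
    have Db: "D v \<in> \<bb>" if "v \<in> \<bb>" for v
      using that Sb ideal yV b by (simp add: D_def subspace_diff)
    have D\<sigma>: "?\<sigma> (D v) = - D (?\<sigma> v)" if v: "v \<in> \<bb>" for v
    proof -
      have mem: "v \<in> ?V" "S v \<in> ?V" "brk T y v \<in> ?V" "?\<sigma> v \<in> ?V" using v bV Sb closed yV \<sigma>(2) by auto
      have "?\<sigma> (brk T y v) = - brk T y (?\<sigma> v)"
        using \<sigma>(4) yV mem \<sigma>_a[OF y(1)] by (simp add: linear_on_minus[OF brk_left V])
      then show ?thesis
        using mem S\<sigma>[OF v] by (simp add: D_def linear_on_diff[OF \<sigma>(1) V])
    qed
    have D_ad: "D (brk T u v) = brk T u (D v)" if u: "u \<in> \<aa>" and v: "v \<in> \<bb>" for u v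
    proof -
      have mem: "u \<in> ?V" "v \<in> ?V" "S v \<in> ?V" "brk T y v \<in> ?V" using u v aV bV Sb closed yV by auto
      have "brk T u (brk T v y) = - brk T u (brk T y v)"
        using skew[OF mem(2) yV] mem by (simp add: linear_on_minus[OF brk_right V])
      moreover have "brk T v (brk T y u) = 0"
        using aa[OF y(1) u] mem by (simp add: linear_on_0[OF brk_right V])
      ultimately have "brk T y (brk T u v) = brk T u (brk T y v)"
        using jacobi[OF yV mem(1,2)] by simp
      then show ?thesis using mem S_ad[OF u v] by (simp add: D_def linear_on_diff[OF brk_right V])
    qed
    \<comment> \<open>For even \<open>v\<close> the bracket \<open>brk T u v\<close> is odd, and
      \<xi> vanishes on the image of odd vectors under \<open>D\<close> by the choice of
      \<open>y\<close>.\<close>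
    have D_plus: "D v = 0" if v: "v \<in> \<bb>" "?\<sigma> v = v" for v
    proof (rule sep)
      show "D v \<in> W" using v Db D\<sigma> by (simp add: W_def)
      fix u assume u: "u \<in> \<aa>"
      have mem: "u \<in> ?V" "v \<in> ?V" using u v aV bV by auto
      have bW: "brk T u v \<in> W"
        using u v mem ideal \<sigma>_a \<sigma>(4) by (simp add: W_def linear_on_minus[OF brk_left V])
      have "\<xi> (D (brk T u v)) = \<xi> (S (brk T u v)) - \<xi> (brk T y (brk T u v))"
        unfolding D_def using bW WV Sb bV yV closed
        by (intro linear_on_diff[OF \<xi>(1) V]) (auto simp: W_def)
      then show "\<xi> (brk T u (D v)) = 0" using y(2)[OF bW] D_ad[OF u v(1)] by simp
    qed
    \<comment> \<open>Here \<open>D v\<close> is even. It commutes with \<bb>, and its bracket with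
      \<open>p2\<close> in \<aa> is, up to sign, \<open>D\<close> of the even vector
      \<open>brk T p2 v\<close>, which is 0.\<close>
    have D_minus: "D v = 0" if v: "v \<in> W" for v
    proof (rule associated_triple_faithful[OF inv lie assoc \<xi>])
      have vb: "v \<in> \<bb>" and vV: "v \<in> ?V" using v bV by (auto simp: W_def)
      have DV: "D v \<in> ?V" using Db[OF vb] bV by auto
      have "D (- v) = - D v"
        using vV yV by (simp add: D_def linear_neg[OF S] linear_on_minus[OF brk_right V])
      then show "D v \<in> K_space T"
        using DV D\<sigma>[OF vb] v by (simp add: K_space_def W_def)
      show "\<xi> (D v) = 0"
        using y(2)[OF v] bV Sb[OF vb] closed[OF yV vV] unfolding D_def
        by (subst linear_on_diff[OF \<xi>(1) V]) auto
      show "brk T (D v) p = 0" if p: "p \<in> P_space T" for p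
      proof -
        obtain p1 p2 where p: "p = p1 + p2" "p1 \<in> \<bb>" "p2 \<in> \<aa>"
          using decomp p unfolding P_space_def by blast
        have mem: "p1 \<in> ?V" "p2 \<in> ?V" using p aV bV by auto
        have "?\<sigma> (brk T p2 v) = brk T p2 v"
          using v vV mem \<sigma>(4) \<sigma>_a[OF p(3)] closed
          by (simp add: W_def linear_on_minus[OF brk_left V] linear_on_minus[OF brk_right V] subspace_neg[OF V])
        then have "D (brk T p2 v) = 0" using D_plus ideal mem vb by blast
        then have "brk T p2 (D v) = 0" using D_ad p(3) vb by simp
        then have "brk T (D v) p2 = 0" using skew[OF DV mem(2)] by simp
        moreover have "brk T (D v) p1 = 0" using bb Db vb p(2) by simp
        ultimately show ?thesis using p(1) DV mem by (simp add: linear_on_add[OF brk_right V])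
      qed
    qed
    have SD: "S v = brk T y v" if v: "v \<in> \<bb>" for v
    proof -
      have mem: "v \<in> ?V" "?\<sigma> v \<in> ?V" "?\<sigma> v \<in> \<bb>" using v bV \<sigma>b \<sigma>(2) by auto
      have "D (v + ?\<sigma> v) = 0"
        using v mem b \<sigma>(3) by (intro D_plus) (auto simp: subspace_add linear_on_add[OF \<sigma>(1) V])
      moreover have "D (v - ?\<sigma> v) = 0"
        using v mem b \<sigma>(3) by (intro D_minus) (auto simp: W_def subspace_diff linear_on_diff[OF \<sigma>(1) V])
      moreover have "D (v + ?\<sigma> v) = D v + D (?\<sigma> v)" "D (v - ?\<sigma> v) = D v - D (?\<sigma> v)"
        using mem yV by (simp_all add: D_def linear_add[OF S] linear_diff[OF S]
            linear_on_add[OF brk_right V] linear_on_diff[OF brk_right V])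
      ultimately have "D v = 0"
        by (metis add_0 add_diff_cancel_left' eq_iff_diff_eq_0 real_vector.scale_eq_0_iff scaleR_2 zero_neq_numeral)
      then show ?thesis by (simp add: D_def)
    qed
    \<comment> \<open>With \<open>y\<close> giving the semisimple part, the remaining element
      \<open>x - y\<close> of \<aa> gives the nilpotent part.\<close>
    have N: "brk T (x - y) v = F v - S v" if v: "v \<in> \<bb>" for v
      using v bV xV yV F(2) SD by (simp add: linear_on_diff[OF brk_left V] subset_iff)
    have xy: "x - y \<in> \<aa>" and xyV: "x - y \<in> ?V" using x y(1) a V xV yV by (simp_all add: subspace_diff)
    have endo: "endomorphism_on \<bb> (brk T u)" if "u \<in> ?V" for u
      using that ideal linear_on_subset[OF brk_right bV] by (auto simp: endomorphism_on_def)
    have "jordan_chevalley \<bb> (brk T x) (brk T (x - y)) (brk T y)"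
      unfolding jordan_chevalley_def
    proof (intro conjI ballI)
      have "brk T (x - y) ` \<bb> \<subseteq> \<bb>" using ideal[OF xyV] by auto
      from nilpotent_on_cong[OF N this] show "nilpotent_on \<bb> (brk T (x - y))"
        using s(3) by (simp add: S_def)
      show "semisimple_on \<bb> (brk T y)"
        using s(2) semisimple_on_cong[OF SD] by (simp add: S_def)
      fix v assume v: "v \<in> \<bb>"
      show "brk T x v = brk T (x - y) v + brk T y v" using N[OF v] SD[OF v] F(2)[OF v] by simp
      have "S (brk T (x - y) v) = brk T (x - y) (S v)" using S_ad xy v by blast
      then show "brk T (x - y) (brk T y v) = brk T y (brk T (x - y) v)"
        using SD v ideal[OF xyV v] by simp
    qed (use endo xyV yV in auto)
    then show ?thesis using xy y(1) by blast
  qed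
  then show ?thesis using eset by (simp add: standard_ESET_def)
qed

section \<open>Transport along a linear embedding\<close>

text \<open>The copy of \<open>T\<close> under \<open>j\<close>, with \<open>i\<close> a left
  inverse of \<open>j\<close> on the carrier in all uses.\<close>

definition image_triple :: "('v::real_vector \<Rightarrow> 'w::real_vector) \<Rightarrow> ('w \<Rightarrow> 'v) \<Rightarrow> 'v triple \<Rightarrow> 'w triple" where
  "image_triple j i T =
     \<lparr> carr = j ` carr T,
       brk = (\<lambda>x y. j (brk T (i x) (i y))),
       invol = (\<lambda>x. j (invol T (i x))),
       form = (\<lambda>x y. form T (i x) (i y)) \<rparr>"

lemma image_triple_simps [simp]:
  "carr (image_triple j i T) = j ` carr T"
  "brk (image_triple j i T) = (\<lambda>x y. j (brk T (i x) (i y)))"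
  "invol (image_triple j i T) = (\<lambda>x. j (invol T (i x)))"
  "form (image_triple j i T) = (\<lambda>x y. form T (i x) (i y))"
  by (simp_all add: image_triple_def)

section \<open>Embedding into finitely supported sequences\<close>

lemma lookup_scaleR:
  "Poly_Mapping.lookup (c *\<^sub>R f) k = c *\<^sub>R Poly_Mapping.lookup (f :: 'a \<Rightarrow>\<^sub>0 'b::real_vector) k"
proof -
  have "finite {k. c *\<^sub>R Poly_Mapping.lookup f k \<noteq> 0}"
    by (rule finite_subset[OF _ finite_lookup[of f]]) auto
  then show ?thesis by (simp add: scaleR_poly_mapping_def)
qed

text \<open>A basis is numbered and sent to unit vectors. Coordinates are read back at the numbers,
  which gives injectivity and a linear left inverse.\<close>

lemma ex_linear_embedding:
  fixes B :: "'v::real_vector set"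
  assumes "finite B"
  obtains j :: "'v \<Rightarrow> nat \<Rightarrow>\<^sub>0 real" and i where "linear j" "linear i" "\<And>x. x \<in> span B \<Longrightarrow> i (j x) = x"
proof -
  obtain C where C: "C \<subseteq> span B" "independent C" "span B \<subseteq> span C"
    by (rule maximal_independent_subset)
  then have "finite C" using independent_span_bound[OF assms] by (meson subset_trans)
  define e where "e = to_nat_on C"
  have e: "inj_on e C"
    unfolding e_def using \<open>finite C\<close> by (intro inj_on_to_nat_on countable_finite)
  obtain j where j: "linear j" "\<forall>c\<in>C. j c = Poly_Mapping.single (e c) (1::real)"
    using linear_independent_extend[OF C(2), of "\<lambda>c. Poly_Mapping.single (e c) (1::real)"] by blast
  interpret j: linear j by (rule j(1))
  have look: "Poly_Mapping.lookup (j (\<Sum>c\<in>C. u c *\<^sub>R c)) (e c) = u c" if "c \<in> C" for u c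
  proof -
    have "Poly_Mapping.lookup (j (\<Sum>c\<in>C. u c *\<^sub>R c)) (e c)
        = (\<Sum>d\<in>C. u d * (if e d = e c then 1 else 0))"
    proof -
      have "j (\<Sum>c\<in>C. u c *\<^sub>R c) = (\<Sum>d\<in>C. u d *\<^sub>R Poly_Mapping.single (e d) 1)"
        using j(2) by (simp add: j.sum j.scale)
      moreover have "Poly_Mapping.lookup (u d *\<^sub>R Poly_Mapping.single (e d) 1) (e c)
          = u d * (if e d = e c then 1 else 0)" for d
        by (simp add: lookup_scaleR lookup_single when_def)
      ultimately show ?thesis by (simp only: lookup_sum)
    qed
    also have "\<dots> = (\<Sum>d\<in>C. if d = c then u d else 0)"
      using e that by (intro sum.cong) (auto dest: inj_onD)
    also have "\<dots> = u c" using that \<open>finite C\<close> by simp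
    finally show ?thesis .
  qed
  have "x = 0" if x: "x \<in> span C" "j x = 0" for x
  proof -
    obtain u where u: "x = (\<Sum>c\<in>C. u c *\<^sub>R c)" using x(1) \<open>finite C\<close> by (auto simp: span_finite)
    have "u c = 0" if "c \<in> C" for c using look[OF that, of u] x(2) u by simp
    then show ?thesis using u by simp
  qed
  then have inj: "inj_on j (span C)" using linear_inj_on_iff_eq_0[OF j(1) subspace_span] by blast
  obtain i where i: "linear i" "\<forall>x\<in>span C. i (j x) = x"
    using linear_exists_left_inverse_on[OF j(1) subspace_span inj] by blast
  show ?thesis by (rule that[OF j(1) i(1)]) (use i(2) C(3) in auto)
qed

section \<open>Invariance of the triple structures under transport\<close>

context
  fixes T :: "'v::real_vector triple" and j :: "'v \<Rightarrow> 'w::real_vector" and i :: "'w \<Rightarrow> 'v"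
  assumes j: "linear j" and i: "linear i" and ij: "\<forall>x\<in>carr T. i (j x) = x"
    and lie: "lie_algebra T"
begin

interpretation j: linear j by (rule j)
interpretation i: linear i by (rule i)

lemma image_triple_mem:
  "x \<in> carr T \<Longrightarrow> y \<in> carr T \<Longrightarrow> x + y \<in> carr T" "x \<in> carr T \<Longrightarrow> c *\<^sub>R x \<in> carr T"
  "x \<in> carr T \<Longrightarrow> - x \<in> carr T" "x \<in> carr T \<Longrightarrow> y \<in> carr T \<Longrightarrow> brk T x y \<in> carr T" "0 \<in> carr T"
  using lie by (auto simp: lie_algebra_def subspace_add subspace_scale subspace_neg subspace_0)

lemma image_triple_inj: "x \<in> carr T \<Longrightarrow> y \<in> carr T \<Longrightarrow> j x = j y \<longleftrightarrow> x = y"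
  by (metis ij)

lemma linear_on_image:
  assumes "linear_on (carr T) f"
  shows "linear_on (j ` carr T) (\<lambda>x. f (i x))"
  using assms unfolding linear_on_def
  by (auto simp: i.add i.scale ij image_triple_mem)

lemma linear_on_image_comp:
  assumes "linear_on (carr T) f"
  shows "linear_on (j ` carr T) (\<lambda>x. j (f (i x)))"
  using assms unfolding linear_on_def
  by (auto simp: i.add i.scale j.add j.scale ij image_triple_mem)

lemma lie_algebra_image: "lie_algebra (image_triple j i T)"
proof -
  have "\<exists>B. finite B \<and> j ` carr T = span B"
    using lie linear_span_image[OF j] unfolding lie_algebra_def by (metis finite_imageI)
  moreover have "subspace (j ` carr T)" using lie linear_subspace_image[OF j] by (simp add: lie_algebra_def)
  moreover have "bilinear_on (j ` carr T) (brk (image_triple j i T))"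
    using lie unfolding bilinear_on_def lie_algebra_def by (auto simp: ij intro!: linear_on_image_comp)
  moreover have "brk T x x = 0" if "x \<in> carr T" for x
    using lie that by (simp add: lie_algebra_def)
  moreover have "brk T x (brk T y z) + brk T y (brk T z x) + brk T z (brk T x y) = 0"
    if "x \<in> carr T" "y \<in> carr T" "z \<in> carr T" for x y z
    using lie that by (simp add: lie_algebra_def)
  ultimately show ?thesis
    unfolding lie_algebra_def by (simp add: ij image_triple_mem j.add[symmetric] j.zero)
qed

lemma involutive_automorphism_image:
  assumes "involutive_automorphism T"
  shows "involutive_automorphism (image_triple j i T)"
  using assms unfolding involutive_automorphism_def
  by (auto simp: ij image_triple_mem intro: linear_on_image_comp)

lemma K_space_image: "involutive_automorphism T \<Longrightarrow> K_space (image_triple j i T) = j ` K_space T"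
  by (auto simp: K_space_def ij image_triple_inj involutive_automorphism_def)

lemma P_space_image: "involutive_automorphism T \<Longrightarrow> P_space (image_triple j i T) = j ` P_space T"
  by (auto simp: P_space_def ij image_triple_inj involutive_automorphism_def j.neg[symmetric] image_triple_mem)

lemma P_space_subset: "x \<in> P_space T \<Longrightarrow> x \<in> carr T" and K_space_subset: "x \<in> K_space T \<Longrightarrow> x \<in> carr T"
  by (auto simp: P_space_def K_space_def)

lemma PP_generates_K_image:
  assumes inv: "involutive_automorphism T" and "PP_generates_K T"
  shows "PP_generates_K (image_triple j i T)"
proof -
  have "{brk (image_triple j i T) x y | x y. x \<in> P_space (image_triple j i T) \<and> y \<in> P_space (image_triple j i T)}
      = j ` {brk T x y | x y. x \<in> P_space T \<and> y \<in> P_space T}"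
    unfolding P_space_image[OF inv] by (force simp: ij P_space_subset)
  then show ?thesis
    using assms(2) unfolding PP_generates_K_def K_space_image[OF inv] by (simp add: linear_span_image[OF j])
qed

lemma K_faithful_on_P_image:
  assumes inv: "involutive_automorphism T" and "K_faithful_on_P T"
  shows "K_faithful_on_P (image_triple j i T)"
proof -
  have "j x = 0 \<longleftrightarrow> x = 0" if "x \<in> carr T" for x
    using image_triple_inj[OF that image_triple_mem(5)] by simp
  then show ?thesis
    using assms(2) unfolding K_faithful_on_P_def K_space_image[OF inv] P_space_image[OF inv]
    by (auto simp: ij P_space_subset K_space_subset image_triple_mem)
qed

lemma chevalley_cocycle_image:
  assumes "chevalley_cocycle T"
  shows "chevalley_cocycle (image_triple j i T)"
  using assms unfolding chevalley_cocycle_def bilinear_on_def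
  by (auto simp: ij image_triple_mem intro!: linear_on_image)

text \<open>An equivalence, because the associated exact triple is defined by a case distinction on
  this property.\<close>

lemma chevalley_coboundary_image: "chevalley_coboundary (image_triple j i T) \<longleftrightarrow> chevalley_coboundary T"
proof
  assume "chevalley_coboundary T"
  then obtain \<xi> where \<xi>: "linear_on (carr T) \<xi>" "\<forall>x\<in>carr T. \<forall>y\<in>carr T. form T x y = \<xi> (brk T x y)"
    by (auto simp: chevalley_coboundary_def)
  then show "chevalley_coboundary (image_triple j i T)"
    unfolding chevalley_coboundary_def
    by (intro exI[of _ "\<lambda>x. \<xi> (i x)"]) (auto simp: ij image_triple_mem linear_on_image)
next
  assume "chevalley_coboundary (image_triple j i T)"
  then obtain \<xi> where \<xi>: "linear_on (j ` carr T) \<xi>"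
    "\<forall>x\<in>j ` carr T. \<forall>y\<in>j ` carr T. form (image_triple j i T) x y = \<xi> (brk (image_triple j i T) x y)"
    unfolding chevalley_coboundary_def image_triple_simps(1) by blast
  then show "chevalley_coboundary T"
    unfolding chevalley_coboundary_def
    by (intro exI[of _ "\<lambda>x. \<xi> (j x)"]) (auto simp: ij linear_on_def j.add j.scale)
qed

lemma K_contraction_zero_image:
  "involutive_automorphism T \<Longrightarrow> K_contraction_zero T \<Longrightarrow> K_contraction_zero (image_triple j i T)"
  by (auto simp: K_contraction_zero_def K_space_image ij K_space_subset)

lemma nondegenerate_on_P_image:
  "involutive_automorphism T \<Longrightarrow> nondegenerate_on_P T \<Longrightarrow> nondegenerate_on_P (image_triple j i T)"
  by (auto simp: nondegenerate_on_P_def P_space_image ij P_space_subset j.zero)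

lemma exact_triple_image: "exact_triple T \<Longrightarrow> exact_triple (image_triple j i T)"
  by (simp add: exact_triple_def lie_algebra_image involutive_automorphism_image PP_generates_K_image
      chevalley_coboundary_image K_contraction_zero_image nondegenerate_on_P_image)

lemma symplectic_triple_image: "symplectic_triple T \<Longrightarrow> symplectic_triple (image_triple j i T)"
  by (simp add: symplectic_triple_def lie_algebra_image involutive_automorphism_image PP_generates_K_image
      K_faithful_on_P_image chevalley_cocycle_image K_contraction_zero_image nondegenerate_on_P_image)

lemma split_abelian_extension_image:
  assumes "split_abelian_extension T \<bb> \<aa>"
  shows "split_abelian_extension (image_triple j i T) (j ` \<bb>) (j ` \<aa>)"
proof -
  from assms have sub: "subspace \<bb>" "subspace \<aa>" "\<bb> \<inter> \<aa> = {0}"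
    and V: "carr T = {x + y | x y. x \<in> \<bb> \<and> y \<in> \<aa>}"
    by (simp_all add: split_abelian_extension_def)
  note b = split_abelian_extension_subset(1)[OF assms, THEN subsetD]
  note a = split_abelian_extension_subset(2)[OF assms, THEN subsetD]
  have "j ` \<bb> \<inter> j ` \<aa> = {0}"
  proof -
    have "j ` \<bb> \<inter> j ` \<aa> = j ` (\<bb> \<inter> \<aa>)"
      using a b by (auto simp: image_triple_inj)
    then show ?thesis by (simp add: sub(3) j.zero)
  qed
  moreover have "j ` carr T = {x + y | x y. x \<in> j ` \<bb> \<and> y \<in> j ` \<aa>}"
  proof (intro set_eqI iffI)
    fix w assume "w \<in> {x + y | x y. x \<in> j ` \<bb> \<and> y \<in> j ` \<aa>}"
    then obtain x y where xy: "x \<in> \<bb>" "y \<in> \<aa>" "w = j x + j y" by blast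
    then have "w = j (x + y)" by (simp add: j.add)
    then show "w \<in> j ` carr T" using xy unfolding V by blast
  qed (force simp: V j.add)
  moreover have "\<forall>x\<in>carr (image_triple j i T). \<forall>y\<in>j ` \<bb>. brk (image_triple j i T) x y \<in> j ` \<bb>"
    "\<forall>x\<in>j ` \<bb>. \<forall>y\<in>j ` \<bb>. brk (image_triple j i T) x y = 0" "\<forall>x\<in>j ` \<aa>. \<forall>y\<in>j ` \<aa>. brk (image_triple j i T) x y = 0"
  proof -
    have "brk T x y \<in> \<bb>" if "x \<in> carr T" "y \<in> \<bb>" for x y
      using assms that unfolding split_abelian_extension_def by blast
    moreover have "brk T x y = 0" if "x \<in> \<bb> \<and> y \<in> \<bb> \<or> x \<in> \<aa> \<and> y \<in> \<aa>" for x y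
      using assms that unfolding split_abelian_extension_def by blast
    ultimately show "\<forall>x\<in>carr (image_triple j i T). \<forall>y\<in>j ` \<bb>. brk (image_triple j i T) x y \<in> j ` \<bb>"
      "\<forall>x\<in>j ` \<bb>. \<forall>y\<in>j ` \<bb>. brk (image_triple j i T) x y = 0" "\<forall>x\<in>j ` \<aa>. \<forall>y\<in>j ` \<aa>. brk (image_triple j i T) x y = 0"
      by (simp_all add: ij a b j.zero)
  qed
  moreover have "subspace (j ` \<bb>)" "subspace (j ` \<aa>)"
    using sub linear_subspace_image[OF j] by simp_all
  ultimately show ?thesis
    unfolding split_abelian_extension_def image_triple_simps(1) by (intro conjI)
qed

lemma iso_to_image: "triple_hom T (image_triple j i T) j" "bij_betw j (carr T) (carr (image_triple j i T))"
  by (auto simp: triple_hom_def linear_on_def j.add j.scale ij bij_betw_def inj_on_def image_triple_inj)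

lemma iso_from_image:
  "involutive_automorphism T \<Longrightarrow> triple_hom (image_triple j i T) T i" "bij_betw i (carr (image_triple j i T)) (carr T)"
proof -
  show "triple_hom (image_triple j i T) T i" if "involutive_automorphism T"
    using that
    by (auto simp: triple_hom_def linear_on_def i.add i.scale ij image_triple_mem involutive_automorphism_def)
  show "bij_betw i (carr (image_triple j i T)) (carr T)"
    by (rule bij_betwI[where g = j]) (auto simp: ij)
qed

lemma iso_central_extension_image:
  "triple_hom (central_extension T) (central_extension (image_triple j i T)) (map_prod j id)"
  "bij_betw (map_prod j id) (carr (central_extension T)) (carr (central_extension (image_triple j i T)))"
proof -
  show "triple_hom (central_extension T) (central_extension (image_triple j i T)) (map_prod j id)"
    by (auto simp: triple_hom_def central_extension_def linear_on_def j.add j.scale ij)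
  show "bij_betw (map_prod j id) (carr (central_extension T)) (carr (central_extension (image_triple j i T)))"
    by (force simp: bij_betw_def central_extension_def inj_on_def image_triple_inj)
qed

end

section \<open>Composition of isomorphisms and transport of ESETs\<close>

lemma triple_hom_comp:
  assumes "triple_hom T1 T2 f" "triple_hom T2 T3 g" "involutive_automorphism T1" "lie_algebra T1"
  shows "triple_hom T1 T3 (g \<circ> f)"
  using assms unfolding triple_hom_def linear_on_def involutive_automorphism_def lie_algebra_def
  by (auto simp: image_subset_iff)

lemma isomorphic_triples_trans:
  assumes "isomorphic_triples T1 T2" "triple_hom T2 T3 g" "bij_betw g (carr T2) (carr T3)"
    and "involutive_automorphism T1" "lie_algebra T1"
  shows "isomorphic_triples T1 T3"
  using assms triple_hom_comp bij_betw_trans unfolding isomorphic_triples_def by blast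

lemma ESET_image:
  fixes T :: "'v::real_vector triple" and j :: "'v \<Rightarrow> nat \<Rightarrow>\<^sub>0 real"
  assumes T: "ESET T \<bb> \<aa>" and j: "linear j" "linear i" "\<forall>x\<in>carr T. i (j x) = x"
  shows "ESET (image_triple j i T) (j ` \<bb>) (j ` \<aa>)"
proof -
  let ?T = "image_triple j i T"
  from T have exact: "exact_triple T" and lie: "lie_algebra T" and inv: "involutive_automorphism T"
    and split: "split_abelian_extension T \<bb> \<aa>" and \<sigma>: "invol T ` \<bb> \<subseteq> \<bb>" "invol T ` \<aa> \<subseteq> \<aa>"
    and assoc: "associated_to_symplectic_symmetric_space T"
    by (simp_all add: ESET_def exact_triple_def)
  note ctxt = j lie
  obtain T0 :: "'v triple" where T0: "symplectic_triple T0" "associated_exact_triple T0 T"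
    using assoc by (auto simp: associated_to_symplectic_symmetric_space_def)
  from T0(1) have lie0: "lie_algebra T0" by (simp add: symplectic_triple_def)
  then obtain B where B: "finite B" "carr T0 = span B" by (auto simp: lie_algebra_def)
  \<comment> \<open>The definition of association wants both triples in one ambient type, so
    \<open>T0\<close> is copied as well, along an embedding of its own.\<close>
  obtain j0 :: "'v \<Rightarrow> nat \<Rightarrow>\<^sub>0 real" and i0 where
    j0: "linear j0" "linear i0" "\<forall>x\<in>carr T0. i0 (j0 x) = x"
    using ex_linear_embedding[OF B(1)] B(2) by metis
  let ?S = "image_triple j0 i0 T0"
  have inv': "involutive_automorphism ?T" and lie': "lie_algebra ?T"
    using involutive_automorphism_image[OF ctxt inv] lie_algebra_image[OF ctxt] by blast+
  have iso: "isomorphic_triples ?T R" if R: "isomorphic_triples T R" for R :: "'r::real_vector triple"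
  proof -
    obtain f where f: "triple_hom T R f" "bij_betw f (carr T) (carr R)"
      using R by (auto simp: isomorphic_triples_def)
    have "isomorphic_triples ?T T"
      using iso_from_image[OF ctxt] inv by (auto simp: isomorphic_triples_def)
    then show ?thesis using isomorphic_triples_trans f inv' lie' by blast
  qed
  \<comment> \<open>The isomorphism runs from the copy of \<open>T\<close> back to \<open>T\<close>,
    on to \<open>T0\<close> or its central extension, and then to the corresponding copy.\<close>
  have "associated_exact_triple ?S ?T"
    using T0(2) isomorphic_triples_trans[OF iso iso_to_image[OF j0 lie0] inv' lie']
      isomorphic_triples_trans[OF iso iso_central_extension_image[OF j0 lie0] inv' lie']
      chevalley_coboundary_image[OF j0 lie0]
    unfolding associated_exact_triple_def by (auto split: if_splits)
  then have "associated_to_symplectic_symmetric_space ?T"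
    using symplectic_triple_image[OF j0 lie0 T0(1)]
    by (auto simp: associated_to_symplectic_symmetric_space_def)
  moreover note split_abelian_extension_subset[OF split]
  then have "invol ?T ` (j ` \<bb>) \<subseteq> j ` \<bb>" "invol ?T ` (j ` \<aa>) \<subseteq> j ` \<aa>"
    using \<sigma> j(3) by (auto simp: image_subset_iff subset_iff)
  ultimately show ?thesis
    using exact_triple_image[OF ctxt exact] split_abelian_extension_image[OF ctxt split]
    by (simp add: ESET_def)
qed

theorem proposition4p7:
  fixes T :: "'v::real_vector triple" and \<bb> \<aa> :: "'v set"
  assumes "ESET T \<bb> \<aa>"
  shows "\<exists>(T' :: (nat \<Rightarrow>\<^sub>0 real) triple) \<bb>' \<aa>'. standard_ESET T' \<bb>' \<aa>' \<and> sub_triple T T'"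
proof -
  from assms obtain B where B: "finite B" "carr T = span B"
    by (auto simp: ESET_def exact_triple_def lie_algebra_def)
  obtain j :: "'v \<Rightarrow> nat \<Rightarrow>\<^sub>0 real" and i
    where j: "linear j" "linear i" "\<And>x. x \<in> span B \<Longrightarrow> i (j x) = x"
    using ex_linear_embedding[OF B(1)] by blast
  have ij: "\<forall>x\<in>carr T. i (j x) = x" using j(3) B(2) by simp
  have lie: "lie_algebra T" using assms by (simp add: ESET_def exact_triple_def)
  \<comment> \<open>The copy is itself standard, so no enlargement takes place and \<open>j\<close>
    is the inclusion.\<close>
  have "standard_ESET (image_triple j i T) (j ` \<bb>) (j ` \<aa>)"
    by (rule ESET_imp_standard_ESET[OF ESET_image[OF assms j(1,2) ij]])
  moreover have "sub_triple T (image_triple j i T)"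
    using iso_to_image[OF j(1,2) ij lie] by (auto simp: sub_triple_def bij_betw_def)
  ultimately show ?thesis by blast
qed

end
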